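(* Let $\beta>0$. There exists a unique pair of functions $A,B:\mathbb N_0^3\to\mathbb R$, extended by zero to $\mathbb Z^3$, such that $A_{(0,0,0)}=1$ and, for all $n=(n_1,n_2,n_3)\in\mathbb Z^3$ and all $\{j,k,\ell\}=\{1,2,3\}$, $$(\mathcal L_\ell A)_n=(\nabla_j\nabla_kB)_n,$$ $$(2n_jn_k+\beta n_j+\beta n_k+\beta n_\ell+\beta^2)A_n=B_{n-e_\ell-e_j}+B_{n-e_\ell-e_k}-B_n-B_{n-e_j-e_k}.$$ Moreover: (i) $A$ and $B$ are symmetric. (ii) $(\mathcal H_jA)_n=(\mathcal H_kA)_n$ for all $n\in\mathbb Z^3$ and $j,k\in\{1,2,3\}$. (iii) For any $n_1,n_2\in\mathbb N_0$, $$A_{(n_1,n_2,0)}=\frac{(\beta)_{n_1}(\beta)_{n_2}(1-2\beta)_{|n_1-n_2|}}{(1)_{n_1}(1)_{n_2}(2\beta)_{|n_1-n_2|}},\qquad B_{(n_1,n_2,0)}=-\frac{(\beta)_{n_1+1}(\beta)_{n_2+1}(1-2\beta)_{|n_1-n_2|}}{(1)_{n_1}(1)_{n_2}(2\beta)_{|n_1-n_2|}}.$$ (iv) For any $n\in\mathbb Z^3$ and $\{j,k,\ell\}=\{1,2,3\}$, $$(P^jM^kA)_{n+e_j}-(P^kM^jA)_{n+e_k}=((P^j-P^k)TA)_n,$$ $$(P^jM^\ell A)_{n+e_j}-(Q^kTA)_{n-e_k}=-((P^k+Q^j)M^jA)_n,$$ $$(Q^jM^jA)_{n-e_j}-(Q^kM^kA)_{n-e_k}=-((P^j-P^k)M^\ell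 A)_n.$$ (v) For $\{j,k,\ell\}=\{1,2,3\}$ define functions on $\mathbb N_0^3$ by $$X^{j,+}_n=(P^jM^kM^\ell A)_{n+e_j}+\big((P^j+2\beta-\tfrac12)M^jTA\big)_n,$$ $$X^{j,-}_n=(Q^jM^jTA)_{n-e_j}+\big((P^j-\beta+\tfrac12)M^kM^\ell A\big)_n.$$ Then the six functions $X^{j,+},X^{j,-}$, $j\in\{1,2,3\}$, are all equal. (vi) For any $n\in\mathbb Z^3$ and $\{j,k,\ell\}=\{1,2,3\}$, $$2(\nabla_\ell B)_n=(P^jM^kA)_{n+e_j}-(Q^jTA)_n=(P^kM^jA)_{n+e_k}-(Q^kTA)_n$$ $$=-(P^jM^\ell A)_{n+e_j+e_k}-(Q^jM^jA)_{n+e_k}=-(P^kM^\ell A)_{n+e_j+e_k}-(Q^kM^kA)_{n+e_j}.$$ (vii) If $2\beta\in\mathbb N$, then $A_n=B_n=0$ when $\min\{M^j_n:j\in\{1,2,3\}\}\le-1$.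
   Context: Notation. $\mathbb N=\{1,2,\dots\}$, $\mathbb N_0=\{0,1,2,\dots\}$, $(q)_m=q(q+1)\cdots(q+m-1)$ with $(q)_0=1$ is the Pochhammer symbol, $e_j$ is the $j$-th unit vector of $\mathbb Z^3$, $|n|=n_1+n_2+n_3$. Functions on $\mathbb N_0^3$ are identified with functions on $\mathbb Z^3$ vanishing outside $\mathbb N_0^3$; the value of $A$ at $n$ is $A_n$. A function on $\mathbb Z^3$ is symmetric if it is invariant under permutations of the coordinates. Products of functions on $\mathbb Z^3$ are pointwise, so e.g. $(P^jM^kA)_m=P^j_mM^k_mA_m$. For $n\in\mathbb Z^3$ and $j\in\{1,2,3\}$: $P^j_n=n_j$, $Q^j_n=n_j+\beta$, $M^j_n=|n|-2n_j-1+2\beta$, $T_n=|n|+1$. For $m\in\mathbb Z$: $f_+(m)=m(m-1+2\beta)$, $f_-(m)=(m+\beta)(m+1-\beta)$. Operators on functions on $\mathbb Z^3$: $(\nabla_jA)_n=A_n-A_{n-e_j}$, $(\mathcal L_jA)_n=f_+(n_j+1)A_{n+e_j}-f_-(n_j)A_n$, and $\mathcal H_j=\nabla_j\mathcal L_j$, i.e. $(\mathcal H_jA)_n=f_+(n_j+1)A_{n+e_j}-(f_+(n_j)+f_-(n_j))A_n+f_-(n_j-1)A_{n-e_j}$. *)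

theory Defs
  imports "HOL-Analysis.Analysis" "HOL-Library.Function_Algebras"
begin

text \<open>
  Points of \<open>\<int>\<^sup>3\<close> have type \<^typ>\<open>int ^ 3\<close>; the elements of the index type \<open>3\<close> are \<open>1, 2, 3\<close>.
  Sums, differences and products of functions on \<open>\<int>\<^sup>3\<close> are pointwise (Function_Algebras).
\<close>

abbreviation evec :: "3 \<Rightarrow> int ^ 3" where
  "evec j \<equiv> axis j 1"

definition in_N0 :: "int ^ 3 \<Rightarrow> bool" where
  "in_N0 n \<longleftrightarrow> (\<forall>i. 0 \<le> n $ i)"

text \<open>A function on \<open>\<nat>\<^sub>0\<^sup>3\<close> is represented by its extension by zero to \<open>\<int>\<^sup>3\<close>.\<close>

definition supported_N0 :: "(int ^ 3 \<Rightarrow> real) \<Rightarrow> bool" where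
  "supported_N0 F \<longleftrightarrow> (\<forall>n. \<not> in_N0 n \<longrightarrow> F n = 0)"

definition symmetric_fun :: "(int ^ 3 \<Rightarrow> real) \<Rightarrow> bool" where
  "symmetric_fun F \<longleftrightarrow> (\<forall>\<sigma>. \<sigma> permutes UNIV \<longrightarrow> (\<forall>n. F (\<chi> i. n $ \<sigma> i) = F n))"

definition absn :: "int ^ 3 \<Rightarrow> int" where
  "absn n = (\<Sum>i\<in>UNIV. n $ i)"

definition Pf :: "3 \<Rightarrow> int ^ 3 \<Rightarrow> real" where
  "Pf j n = of_int (n $ j)"

definition Qf :: "real \<Rightarrow> 3 \<Rightarrow> int ^ 3 \<Rightarrow> real" where
  "Qf \<beta> j n = of_int (n $ j) + \<beta>"

definition Mf :: "real \<Rightarrow> 3 \<Rightarrow> int ^ 3 \<Rightarrow> real" where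
  "Mf \<beta> j n = of_int (absn n - 2 * n $ j - 1) + 2 * \<beta>"

definition Tf :: "int ^ 3 \<Rightarrow> real" where
  "Tf n = of_int (absn n + 1)"

definition f_plus :: "real \<Rightarrow> int \<Rightarrow> real" where
  "f_plus \<beta> m = of_int m * (of_int m - 1 + 2 * \<beta>)"

definition f_minus :: "real \<Rightarrow> int \<Rightarrow> real" where
  "f_minus \<beta> m = (of_int m + \<beta>) * (of_int m + 1 - \<beta>)"

definition nabla :: "3 \<Rightarrow> (int ^ 3 \<Rightarrow> real) \<Rightarrow> int ^ 3 \<Rightarrow> real" where
  "nabla j F n = F n - F (n - evec j)"

definition Lop :: "real \<Rightarrow> 3 \<Rightarrow> (int ^ 3 \<Rightarrow> real) \<Rightarrow> int ^ 3 \<Rightarrow> real" where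
  "Lop \<beta> j F n = f_plus \<beta> (n $ j + 1) * F (n + evec j) - f_minus \<beta> (n $ j) * F n"

definition Hop :: "real \<Rightarrow> 3 \<Rightarrow> (int ^ 3 \<Rightarrow> real) \<Rightarrow> int ^ 3 \<Rightarrow> real" where
  "Hop \<beta> j F = nabla j (Lop \<beta> j F)"

lemma Hop_explicit:
  "Hop \<beta> j F n = f_plus \<beta> (n $ j + 1) * F (n + evec j)
     - (f_plus \<beta> (n $ j) + f_minus \<beta> (n $ j)) * F n
     + f_minus \<beta> (n $ j - 1) * F (n - evec j)"
  by (simp add: Hop_def nabla_def Lop_def axis_def algebra_simps)

definition AB_system :: "real \<Rightarrow> (int ^ 3 \<Rightarrow> real) \<Rightarrow> (int ^ 3 \<Rightarrow> real) \<Rightarrow> bool" where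
  "AB_system \<beta> A B \<longleftrightarrow>
     supported_N0 A \<and> supported_N0 B \<and> A 0 = 1 \<and>
     (\<forall>n j k l. {j, k, l} = {1, 2, 3} \<longrightarrow>
        Lop \<beta> l A n = nabla j (nabla k B) n \<and>
        (2 * of_int (n $ j) * of_int (n $ k)
           + \<beta> * of_int (n $ j) + \<beta> * of_int (n $ k) + \<beta> * of_int (n $ l) + \<beta>\<^sup>2) * A n
        = B (n - evec l - evec j) + B (n - evec l - evec k) - B n - B (n - evec j - evec k))"

text \<open>In \<open>X_plus\<close> and \<open>X_minus\<close>, \<open>k\<close> and \<open>l\<close> stand for the two indices other than \<open>j\<close>.\<close>

definition X_plus ::
    "real \<Rightarrow> (int ^ 3 \<Rightarrow> real) \<Rightarrow> 3 \<Rightarrow> 3 \<Rightarrow> 3 \<Rightarrow> int ^ 3 \<Rightarrow> real" where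
  "X_plus \<beta> A j k l n =
     (Pf j * Mf \<beta> k * Mf \<beta> l * A) (n + evec j)
     + ((Pf j + (\<lambda>_. 2 * \<beta> - 1 / 2)) * Mf \<beta> j * Tf * A) n"

definition X_minus ::
    "real \<Rightarrow> (int ^ 3 \<Rightarrow> real) \<Rightarrow> 3 \<Rightarrow> 3 \<Rightarrow> 3 \<Rightarrow> int ^ 3 \<Rightarrow> real" where
  "X_minus \<beta> A j k l n =
     (Qf \<beta> j * Mf \<beta> j * Tf * A) (n - evec j)
     + ((Pf j + (\<lambda>_. - \<beta> + 1 / 2)) * Mf \<beta> k * Mf \<beta> l * A) n"

end

theory Submission
  imports Defs
begin

text \<open>
  Call \<open>X\<close> the common value of the six functions in (v). These six relations determine
  \<open>(A, X)\<close> at \<open>n + e\<^sub>j\<close> from \<open>(A, X)\<close> at \<open>n\<close>, as long as no \<open>M\<^sup>j\<close> vanishes, i.e. for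
  \<open>2\<beta> \<notin> \<int>\<close>. The transition maps in the three directions commute, so they integrate to a solution
  on \<open>\<nat>\<^sub>0\<^sup>3\<close>; on the faces \<open>n\<^sub>j = 0\<close> the vector stays on the line that allows extension by zero.
  Then \<open>B\<close> is an explicit linear combination of \<open>A\<close> and \<open>X\<close>, and dividing by the \<open>M\<^sup>j\<close> gives (iv).

  The original system determines \<open>A\<^sub>n\<close> and \<open>B\<^sub>n\<close> recursively, with denominators \<open>f\<^sub>+(m)\<close>, \<open>m \<ge> 1\<close>, that are
  positive for \<open>\<beta> > 0\<close>. Hence the solution is unique and continuous in \<open>\<beta>\<close>, and (iv) with a
  first-order relation for \<open>B\<close> extend to all \<open>\<beta> > 0\<close>; the system, (v) and (vi) follow
  from these two without division.
\<close>

section \<open>Coordinates\<close>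

lemma triple_distinct:
  assumes "{j, k, l} = {1, 2, 3 :: 3}"
  shows "j \<noteq> k" "j \<noteq> l" "k \<noteq> l" "k \<noteq> j" "l \<noteq> j" "l \<noteq> k"
proof -
  have "card {j, k, l} = 3" unfolding assms by simp
  then show "j \<noteq> k" "j \<noteq> l" "k \<noteq> l" "k \<noteq> j" "l \<noteq> j" "l \<noteq> k"
    by (auto simp: card_insert_if split: if_splits)
qed

lemma triple_permute:
  assumes "{j, k, l} = {1, 2, 3 :: 3}"
  shows "{j, l, k} = {1, 2, 3}" "{k, j, l} = {1, 2, 3}" "{k, l, j} = {1, 2, 3}"
    "{l, j, k} = {1, 2, 3}" "{l, k, j} = {1, 2, 3}"
  using assms by auto

lemma absn_triple:
  assumes "{j, k, l} = {1, 2, 3 :: 3}"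
  shows "absn n = n $ j + n $ k + n $ l"
proof -
  have "absn n = (\<Sum>i\<in>{j, k, l}. n $ i)"
    unfolding absn_def using assms UNIV_3 by metis
  then show ?thesis using triple_distinct[OF assms] by simp
qed

lemma absn_shift [simp]:
  "absn (n + evec j) = absn n + 1" "absn (n - evec j) = absn n - 1" "absn 0 = 0"
  by (simp_all add: absn_def sum.distrib sum_subtractf axis_def)

lemma evec_shift: "evec j $ i = (if i = j then 1 else 0)"
  by (simp add: axis_def)

lemma in_N0_triple:
  assumes "{j, k, l} = {1, 2, 3 :: 3}"
  shows "in_N0 n \<longleftrightarrow> 0 \<le> n $ j \<and> 0 \<le> n $ k \<and> 0 \<le> n $ l"
proof -
  have "(\<forall>i. 0 \<le> n $ i) \<longleftrightarrow> (\<forall>i\<in>{j, k, l}. 0 \<le> n $ i)"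
    using assms UNIV_3 by (metis UNIV_I)
  then show ?thesis by (simp add: in_N0_def)
qed

section \<open>First-order relations and their division-free consequences\<close>

lemmas fun_unfold = Pf_def Qf_def Mf_def Tf_def nabla_def X_plus_def X_minus_def

text \<open>The last relation is the one for \<open>B\<close> from which (vi) follows by (iv) without division.\<close>

definition contiguous :: "real \<Rightarrow> (int ^ 3 \<Rightarrow> real) \<Rightarrow> (int ^ 3 \<Rightarrow> real) \<Rightarrow> bool" where
  "contiguous \<beta> A B \<longleftrightarrow> (\<forall>n j k l. {j, k, l} = {1, 2, 3} \<longrightarrow>
     (Pf j * Mf \<beta> k * A) (n + evec j) - (Pf k * Mf \<beta> j * A) (n + evec k)
       = ((Pf j - Pf k) * Tf * A) n \<and>
     (Pf j * Mf \<beta> l * A) (n + evec j) - (Qf \<beta> k * Tf * A) (n - evec k)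
       = - ((Pf k + Qf \<beta> j) * Mf \<beta> j * A) n \<and>
     (Qf \<beta> j * Mf \<beta> j * A) (n - evec j) - (Qf \<beta> k * Mf \<beta> k * A) (n - evec k)
       = - ((Pf j - Pf k) * Mf \<beta> l * A) n \<and>
     2 * nabla l B n = (Qf \<beta> l * Tf * A) (n - evec l)
       - (2 * of_int (n $ j) * of_int (n $ k) + of_int (n $ l) * (of_int (absn n) - 1 + 2 * \<beta>)
          + 2 * \<beta> * (of_int (absn n) + \<beta>)) * A n)"

text \<open>In the scalars \<open>p\<close>, \<open>q\<close>, \<open>r\<close> the relations are
  polynomial identities that \<open>algebra\<close> can combine.\<close>

lemma contiguousD:
  fixes n :: "int ^ 3"
  assumes "contiguous \<beta> A B" "{j, k, l} = {1, 2, 3}"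
  defines "p \<equiv> of_int (n $ j) :: real" and "q \<equiv> of_int (n $ k)" and "r \<equiv> of_int (n $ l)"
  shows "(p + 1) * (p + r - q + 2 * \<beta>) * A (n + evec j)
           - (q + 1) * (q + r - p + 2 * \<beta>) * A (n + evec k) = (p - q) * (p + q + r + 1) * A n"
    and "(p + 1) * (p + q - r + 2 * \<beta>) * A (n + evec j)
           - (q - 1 + \<beta>) * (p + q + r) * A (n - evec k)
         = - (p + q + \<beta>) * (q + r - p - 1 + 2 * \<beta>) * A n"
    and "2 * (B n - B (n - evec l)) = (r - 1 + \<beta>) * (p + q + r) * A (n - evec l)
           - (2 * p * q + r * (p + q + r - 1 + 2 * \<beta>) + 2 * \<beta> * (p + q + r + \<beta>)) * A n"
proof -
  note d = triple_distinct[OF assms(2)] and c = assms(1)[unfolded contiguous_def, rule_format, OF assms(2), of n]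
  show "(p + 1) * (p + r - q + 2 * \<beta>) * A (n + evec j)
           - (q + 1) * (q + r - p + 2 * \<beta>) * A (n + evec k) = (p - q) * (p + q + r + 1) * A n"
    using c[THEN conjunct1] d
    by (simp add: p_def q_def r_def fun_unfold evec_shift absn_triple[OF assms(2)] algebra_simps)
  show "(p + 1) * (p + q - r + 2 * \<beta>) * A (n + evec j)
           - (q - 1 + \<beta>) * (p + q + r) * A (n - evec k)
         = - (p + q + \<beta>) * (q + r - p - 1 + 2 * \<beta>) * A n"
    using c[THEN conjunct2, THEN conjunct1] d
    by (simp add: p_def q_def r_def fun_unfold evec_shift absn_triple[OF assms(2)] algebra_simps)
  show "2 * (B n - B (n - evec l)) = (r - 1 + \<beta>) * (p + q + r) * A (n - evec l)
           - (2 * p * q + r * (p + q + r - 1 + 2 * \<beta>) + 2 * \<beta> * (p + q + r + \<beta>)) * A n"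
    using c[THEN conjunct2, THEN conjunct2, THEN conjunct2] d
    by (simp add: p_def q_def r_def fun_unfold evec_shift absn_triple[OF assms(2)] algebra_simps)
qed

lemma contiguous_nabla:
  fixes n :: "int ^ 3"
  assumes "contiguous \<beta> A B" "{j, k, l} = {1, 2, 3}"
  defines "p \<equiv> of_int (n $ j) :: real" and "q \<equiv> of_int (n $ k)" and "r \<equiv> of_int (n $ l)"
  shows "2 * (B n - B (n - evec l)) = (p + 1) * (p + r - q + 2 * \<beta>) * A (n + evec j)
           - (p + \<beta>) * (p + q + r + 1) * A n"
    and "2 * (B n - B (n - evec l)) = - (p + 1) * (p + q - r + 1 + 2 * \<beta>) * A (n + evec j + evec k)
           - (p + \<beta>) * (q + r - p + 2 * \<beta>) * A (n + evec k)"
proof -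
  \<comment> \<open>The second relation with \<open>k\<close> and \<open>l\<close> exchanged
    contains the same multiple of \<open>A (n - evec l)\<close> as the relation for
    \<open>B\<close>, with opposite sign; adding the two eliminates it.\<close>
  have main: "2 * (B n - B (n - evec l)) = (of_int (n $ j) + 1) * (of_int (n $ j) + of_int (n $ l) - of_int (n $ k) + 2 * \<beta>) * A (n + evec j)
           - (of_int (n $ j) + \<beta>) * (of_int (n $ j) + of_int (n $ k) + of_int (n $ l) + 1) * A n"
    if "{j, k, l} = {1, 2, 3}" for j k l
    using contiguousD(2)[OF assms(1) triple_permute(1)[OF that], of n]
      contiguousD(3)[OF assms(1) that, of n]
    by algebra
  show "2 * (B n - B (n - evec l)) = (p + 1) * (p + r - q + 2 * \<beta>) * A (n + evec j)
           - (p + \<beta>) * (p + q + r + 1) * A n"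
    unfolding p_def q_def r_def by (rule main[OF assms(2)])
  have "A (n + evec k + evec j) = A (n + evec j + evec k)"
    by (simp add: add_ac)
  then show "2 * (B n - B (n - evec l)) = - (p + 1) * (p + q - r + 1 + 2 * \<beta>) * A (n + evec j + evec k)
           - (p + \<beta>) * (q + r - p + 2 * \<beta>) * A (n + evec k)"
    \<comment> \<open>Here \<open>main\<close> has \<open>j\<close> and \<open>k\<close> exchanged,
      and the second relation at \<open>n + evec k\<close> removes its term in
      \<open>A n\<close>.\<close>
    using main[OF triple_permute(2)[OF assms(2)]] triple_distinct[OF assms(2)]
      contiguousD(2)[OF assms(1,2), of "n + evec k"]
    by (simp add: evec_shift p_def q_def r_def algebra_simps)
qed

lemma contiguous_AB_system:
  assumes "contiguous \<beta> A B" "supported_N0 A" "supported_N0 B" "A 0 = 1"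
  shows "AB_system \<beta> A B"
  unfolding AB_system_def
proof (intro conjI allI impI)
  fix n j k l assume t: "{j, k, l} = {1, 2, 3 :: 3}"
  note d = triple_distinct[OF t] and t' = triple_permute[OF t]
  \<comment> \<open>The difference in direction \<open>k\<close> is taken at \<open>n\<close> in the
    first form of \<open>contiguous_nabla\<close> and at \<open>n - evec j\<close> in the second
    form; both then involve only \<open>A (n + evec l)\<close> and \<open>A n\<close>.\<close>
  have "2 * Lop \<beta> l A n = 2 * ((B n - B (n - evec k)) - (B (n - evec j) - B (n - evec j - evec k)))"
    using contiguous_nabla(1)[OF assms(1) t'(5), of n] d
      contiguous_nabla(1)[OF assms(1) t'(4), of n]
      contiguous_nabla(2)[OF assms(1) t'(4), of "n - evec j"]
    by (simp add: Lop_def f_plus_def f_minus_def evec_shift algebra_simps)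
  then show "Lop \<beta> l A n = nabla j (nabla k B) n"
    by (simp add: nabla_def)
  have e: "n - evec k - evec l = n - evec l - evec k" "n - evec k - evec j = n - evec j - evec k"
    by (simp_all add: algebra_simps)
  \<comment> \<open>The right side is a telescoping sum of four first differences, chosen so that
    the terms in \<open>A (n - evec l)\<close> and \<open>A (n - evec k)\<close> cancel.\<close>
  have "2 * ((2 * of_int (n $ j) * of_int (n $ k)
           + \<beta> * of_int (n $ j) + \<beta> * of_int (n $ k) + \<beta> * of_int (n $ l) + \<beta>\<^sup>2) * A n)
        = 2 * (- (B n - B (n - evec l)) - (B (n - evec l) - B (n - evec l - evec j))
          + (B (n - evec k) - B (n - evec k - evec j)) - (B (n - evec k) - B (n - evec k - evec l)))"
    using contiguousD(3)[OF assms(1) t, of n] d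
      contiguous_nabla(1)[OF assms(1) t'(5), of "n - evec l"]
      contiguous_nabla(1)[OF assms(1) t'(3), of "n - evec k"]
      contiguous_nabla(1)[OF assms(1) t'(2), of "n - evec k"]
    by (simp add: evec_shift power2_eq_square algebra_simps)
  then show "(2 * of_int (n $ j) * of_int (n $ k)
           + \<beta> * of_int (n $ j) + \<beta> * of_int (n $ k) + \<beta> * of_int (n $ l) + \<beta>\<^sup>2) * A n
        = B (n - evec l - evec j) + B (n - evec l - evec k) - B n - B (n - evec j - evec k)"
    by (simp add: e)
qed (use assms in auto)

lemma X_expand:
  fixes n :: "int ^ 3"
  assumes "{j, k, l} = {1, 2, 3}"
  defines "p \<equiv> of_int (n $ j) :: real" and "q \<equiv> of_int (n $ k)" and "r \<equiv> of_int (n $ l)"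
  shows "X_plus \<beta> A j k l n = (p + 1) * (p + r - q + 2 * \<beta>) * (p + q - r + 2 * \<beta>) * A (n + evec j)
      + (p + 2 * \<beta> - 1 / 2) * (q + r - p - 1 + 2 * \<beta>) * (p + q + r + 1) * A n"
    and "X_minus \<beta> A j k l n = (p - 1 + \<beta>) * (q + r - p + 2 * \<beta>) * (p + q + r) * A (n - evec j)
      + (p - \<beta> + 1 / 2) * (p + r - q - 1 + 2 * \<beta>) * (p + q - r - 1 + 2 * \<beta>) * A n"
  using triple_distinct[OF assms(1)]
  by (simp_all add: p_def q_def r_def fun_unfold evec_shift absn_triple[OF assms(1)] algebra_simps add_divide_distrib)

text \<open>Multiplied by the value of \<open>Mf\<close> in direction \<open>l\<close> at
  \<open>n + evec j\<close>, the first relation equates \<open>X_plus\<close> for \<open>j\<close>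
  and for \<open>k\<close>. Multiplied in the same way, the second relation equates
  \<open>X_plus\<close> for \<open>k\<close> with \<open>X_minus\<close> for \<open>j\<close>.
  Nothing is divided, so no condition on \<beta> enters.\<close>

lemma contiguous_X:
  assumes "contiguous \<beta> A B" "{j, k, l} = {1, 2, 3}"
  shows "X_plus \<beta> A j k l n = X_plus \<beta> A 1 2 3 n" "X_minus \<beta> A j k l n = X_plus \<beta> A 1 2 3 n"
proof -
  have plus: "X_plus \<beta> A j k l n = X_plus \<beta> A k j l n" if t: "{j, k, l} = {1, 2, 3}" for j k l
    using contiguousD(1)[OF assms(1) t, of n]
    unfolding X_expand[OF t] X_expand[OF triple_permute(2)[OF t]] by algebra
  have swap: "X_plus \<beta> A j k l n = X_plus \<beta> A j l k n" if "{j, k, l} = {1, 2, 3}" for j k l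
    by (simp add: X_plus_def algebra_simps)
  have plus_all: "X_plus \<beta> A j k l n = X_plus \<beta> A 1 2 3 n" if t: "{j, k, l} = {1, 2, 3}" for j k l
  proof -
    note d = triple_distinct[OF t] and t' = triple_permute[OF t]
    \<comment> \<open>Exchanging the first two indices and exchanging the last two generate all six
      orderings.\<close>
    have "X_plus \<beta> A j k l n = X_plus \<beta> A j' k' l' n"
      if "j' = j \<and> k' = k \<and> l' = l \<or> j' = j \<and> k' = l \<and> l' = k \<or> j' = k \<and> k' = j \<and> l' = l
       \<or> j' = k \<and> k' = l \<and> l' = j \<or> j' = l \<and> k' = j \<and> l' = k \<or> j' = l \<and> k' = k \<and> l' = j" for j' k' l'
      using that plus[OF t] swap[OF t] swap[OF t'(2)] plus[OF t'(1)] swap[OF t'(4)] by auto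
    moreover have "1 \<in> {j, k, l}" "2 \<in> {j, k, l}" "3 \<in> {j, k, l}" unfolding t by auto
    ultimately show ?thesis by auto
  qed
  show "X_plus \<beta> A j k l n = X_plus \<beta> A 1 2 3 n" by (rule plus_all[OF assms(2)])
  note t = triple_permute(2)[OF assms(2)]
  have "X_plus \<beta> A k j l n = X_minus \<beta> A j k l n"
    using contiguousD(2)[OF assms(1) t, of n]
    unfolding X_expand(1)[OF t] X_expand(2)[OF assms(2)] by algebra
  then show "X_minus \<beta> A j k l n = X_plus \<beta> A 1 2 3 n" using plus_all[OF t] by simp
qed

section \<open>Generic parameters\<close>

lemma of_int_plus_generic:
  assumes "2 * \<beta> \<notin> \<int>"
  shows "of_int m + 2 * \<beta> \<noteq> (0 :: real)"
proof
  assume "of_int m + 2 * \<beta> = 0"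
  then have "2 * \<beta> = of_int (- m)" by simp
  then show False using assms by (metis Ints_of_int)
qed

text \<open>The formula for \<open>B\<close> was found by fitting an ansatz to computed values; on the face
  \<open>n\<^sub>3 = 0\<close> it reduces to \<open>- (n\<^sub>1 + \<beta>) (n\<^sub>2 + \<beta>) A\<^sub>n\<close>.\<close>

lemma contiguous_generic:
  assumes \<beta>: "2 * \<beta> \<notin> \<int>" and A: "supported_N0 A"
    and X: "\<And>n j k l. {j, k, l} = {1, 2, 3} \<Longrightarrow> X_plus \<beta> A j k l n = X n"
      "\<And>n j k l. {j, k, l} = {1, 2, 3} \<Longrightarrow> X_minus \<beta> A j k l n = X n"
  defines "B \<equiv> \<lambda>n. - ((of_int (absn n))\<^sup>2 + 4 * \<beta> * of_int (absn n) + 4 * \<beta> - 1) / 4 * A n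
    - X n / (2 - 4 * \<beta>)"
  shows "contiguous \<beta> A B"
  unfolding contiguous_def
proof (intro allI impI conjI)
  fix n j k l assume t: "{j, k, l} = {1, 2, 3 :: 3}"
  note d = triple_distinct[OF t] and t' = triple_permute[OF t]
  define p q r :: real where "p = of_int (n $ j)" and "q = of_int (n $ k)" and "r = of_int (n $ l)"
  note pqr = p_def[symmetric] q_def[symmetric] r_def[symmetric]
  have nz: "p + q - r + 2 * \<beta> \<noteq> 0" "p + r - q + 2 * \<beta> \<noteq> 0"
    using of_int_plus_generic[OF \<beta>, of "n $ j + n $ k - n $ l"]
      of_int_plus_generic[OF \<beta>, of "n $ j + n $ l - n $ k"] by (simp_all add: p_def q_def r_def)
  \<comment> \<open>Equality of \<open>X_plus\<close> for \<open>j\<close> and \<open>k\<close> is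
    the first relation times a value of \<open>Mf\<close> in direction \<open>l\<close>, which is
    nonzero because 2\<beta> is not an integer.\<close>
  have "(p + q - r + 2 * \<beta>) * ((p + 1) * (p + r - q + 2 * \<beta>) * A (n + evec j)
      - (q + 1) * (q + r - p + 2 * \<beta>) * A (n + evec k)) = (p + q - r + 2 * \<beta>) * ((p - q) * (p + q + r + 1) * A n)"
    using trans[OF X(1)[OF t, of n] X(1)[OF t'(2), of n, symmetric]]
    unfolding X_expand[OF t] X_expand[OF t'(2)] pqr by algebra
  then have "(p + 1) * (p + r - q + 2 * \<beta>) * A (n + evec j)
      - (q + 1) * (q + r - p + 2 * \<beta>) * A (n + evec k) = (p - q) * (p + q + r + 1) * A n"
    using nz by simp
  then show "(Pf j * Mf \<beta> k * A) (n + evec j) - (Pf k * Mf \<beta> j * A) (n + evec k)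
       = ((Pf j - Pf k) * Tf * A) n"
    using d by (simp add: p_def q_def r_def fun_unfold evec_shift absn_triple[OF t] algebra_simps)
  have iv2: "(p + 1) * (p + q - r + 2 * \<beta>) * A (n + evec j)
      - (q - 1 + \<beta>) * (p + q + r) * A (n - evec k) = - (p + q + \<beta>) * (q + r - p - 1 + 2 * \<beta>) * A n"
    if t: "{j, k, l} = {1, 2, 3}" and pqr: "p = of_int (n $ j)" "q = of_int (n $ k)" "r = of_int (n $ l)"
    for j k l p q r
  proof -
    have "p + r - q + 2 * \<beta> \<noteq> 0"
      using of_int_plus_generic[OF \<beta>, of "n $ j + n $ l - n $ k"] by (simp add: pqr)
    moreover have "(p + r - q + 2 * \<beta>) * ((p + 1) * (p + q - r + 2 * \<beta>) * A (n + evec j)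
        - (q - 1 + \<beta>) * (p + q + r) * A (n - evec k))
       = (p + r - q + 2 * \<beta>) * (- (p + q + \<beta>) * (q + r - p - 1 + 2 * \<beta>) * A n)"
      using trans[OF X(1)[OF t, of n] X(2)[OF triple_permute(2)[OF t], of n, symmetric]]
      unfolding X_expand[OF t] X_expand[OF triple_permute(2)[OF t]] pqr[symmetric] by algebra
    ultimately show ?thesis by simp
  qed
  show "(Pf j * Mf \<beta> l * A) (n + evec j) - (Qf \<beta> k * Tf * A) (n - evec k)
       = - ((Pf k + Qf \<beta> j) * Mf \<beta> j * A) n"
    using iv2[OF t p_def q_def r_def] d
    by (simp add: p_def q_def r_def fun_unfold evec_shift absn_triple[OF t] algebra_simps)
  have "(p - 1 + \<beta>) * (q + r - p + 2 * \<beta>) * A (n - evec j)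
      - (q - 1 + \<beta>) * (p + r - q + 2 * \<beta>) * A (n - evec k) = - (p - q) * (p + q - r - 1 + 2 * \<beta>) * A n"
  \<comment> \<open>The factor to cancel here is |n|. Where it is zero, both shifted points have
    coordinate sum -1, so \<open>A\<close> vanishes there, and \<open>A n\<close> can be nonzero
    only at the origin, where \<open>p = q\<close>.\<close>
  proof (cases "p + q + r = 0")
    case False
    have "(p + q + r) * ((p - 1 + \<beta>) * (q + r - p + 2 * \<beta>) * A (n - evec j)
      - (q - 1 + \<beta>) * (p + r - q + 2 * \<beta>) * A (n - evec k))
      = (p + q + r) * (- (p - q) * (p + q - r - 1 + 2 * \<beta>) * A n)"
      using trans[OF X(2)[OF t, of n] X(2)[OF t'(2), of n, symmetric]]
      unfolding X_expand[OF t] X_expand[OF t'(2)] pqr by algebra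
    then show ?thesis using False by simp
  next
    case True
    then have 0: "n $ j + n $ k + n $ l = 0" unfolding p_def q_def r_def by linarith
    have "A (n - evec j) = 0" "A (n - evec k) = 0"
      using A 0 d unfolding supported_N0_def in_N0_triple[OF t] by (auto simp: evec_shift)
    moreover have "A n = 0 \<or> n $ j = n $ k"
    proof (cases "in_N0 n")
      case True
      then show ?thesis using 0 unfolding in_N0_triple[OF t] by linarith
    qed (use A in \<open>simp add: supported_N0_def\<close>)
    then have "(p - q) * A n = 0" by (auto simp: p_def q_def)
    ultimately show ?thesis by auto
  qed
  then show "(Qf \<beta> j * Mf \<beta> j * A) (n - evec j) - (Qf \<beta> k * Mf \<beta> k * A) (n - evec k)
       = - ((Pf j - Pf k) * Mf \<beta> l * A) n"
    using d by (simp add: p_def q_def r_def fun_unfold evec_shift absn_triple[OF t] algebra_simps)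
  have *: "(2 - 4 * \<beta>) \<noteq> 0"
    using of_int_plus_generic[OF \<beta>, of "-1"] by simp
  \<comment> \<open>The difference of \<open>X\<close> in direction \<open>l\<close> is computed
    from \<open>X_minus\<close> at \<open>n\<close> and \<open>X_plus\<close> at
    \<open>n - evec l\<close>, so that only \<open>A n\<close> and \<open>A (n - evec l)\<close>
    occur. Their common factor 1/2 - \<beta> cancels against 2 - 4\<beta> in
    \<open>B\<close>.\<close>
  have "X n = (r - 1 + \<beta>) * (p + q - r + 2 * \<beta>) * (r + p + q) * A (n - evec l)
      + (r - \<beta> + 1 / 2) * (r + q - p - 1 + 2 * \<beta>) * (r + p - q - 1 + 2 * \<beta>) * A n"
    using X(2)[OF t'(4), of n] unfolding X_expand[OF t'(4)] pqr by simp
  moreover have "X (n - evec l) = r * (r - 1 + q - p + 2 * \<beta>) * (r - 1 + p - q + 2 * \<beta>) * A n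
      + (r - 1 + 2 * \<beta> - 1 / 2) * (p + q - r + 2 * \<beta>) * (r + p + q) * A (n - evec l)"
    using X(1)[OF t'(4), of "n - evec l"] d unfolding X_expand[OF t'(4)]
    by (simp add: evec_shift pqr add_ac add_diff_eq diff_add_eq)
  ultimately have x: "X n - X (n - evec l) = (1 / 2 - \<beta>) * ((p + q - r + 2 * \<beta>) * (p + q + r) * A (n - evec l)
      + (q + r - p - 1 + 2 * \<beta>) * (p + r - q - 1 + 2 * \<beta>) * A n)"
    by algebra
  have x: "(X n - X (n - evec l)) / (2 - 4 * \<beta>) = 1 / 4 * ((p + q - r + 2 * \<beta>) * (p + q + r) * A (n - evec l)
      + (q + r - p - 1 + 2 * \<beta>) * (p + r - q - 1 + 2 * \<beta>) * A n)"
    unfolding x using * by (simp add: field_simps)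
  define s where "s = p + q + r"
  have s: "of_int (absn n) = s" by (simp add: s_def p_def q_def r_def absn_triple[OF t])
  have "2 * (B n - B (n - evec l)) = - (s\<^sup>2 + 4 * \<beta> * s + 4 * \<beta> - 1) / 2 * A n
     + ((s - 1)\<^sup>2 + 4 * \<beta> * (s - 1) + 4 * \<beta> - 1) / 2 * A (n - evec l) - 2 * ((X n - X (n - evec l)) / (2 - 4 * \<beta>))"
    by (simp add: B_def s diff_divide_distrib add_divide_distrib algebra_simps)
  also have "\<dots> = (r - 1 + \<beta>) * s * A (n - evec l)
       - (2 * p * q + r * (s - 1 + 2 * \<beta>) + 2 * \<beta> * (s + \<beta>)) * A n"
    unfolding x by (simp add: s_def power2_eq_square field_simps)
  finally show "2 * nabla l B n = (Qf \<beta> l * Tf * A) (n - evec l)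
       - (2 * of_int (n $ j) * of_int (n $ k) + of_int (n $ l) * (of_int (absn n) - 1 + 2 * \<beta>)
          + 2 * \<beta> * (of_int (absn n) + \<beta>)) * A n"
    by (simp add: fun_unfold evec_shift s pqr algebra_simps)
qed

text \<open>The transition map \<open>(A\<^sub>n, X\<^sub>n) \<mapsto> (A, X)\<close> at \<open>n + e\<^sub>j\<close>, where \<open>(p, q, r) = (n\<^sub>j, n\<^sub>k, n\<^sub>l)\<close>: the first component
  solves \<open>X\<^sup>j\<^sup>,\<^sup>+\<^sub>n = X\<^sub>n\<close>, the second is \<open>X\<^sup>j\<^sup>,\<^sup>-\<close> at \<open>n + e\<^sub>j\<close>.\<close>

definition ustep :: "real \<Rightarrow> real \<Rightarrow> real \<Rightarrow> real \<Rightarrow> real \<times> real \<Rightarrow> real \<times> real" where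
  "ustep \<beta> p q r v =
    (let a = (snd v - (p + 2 * \<beta> - 1 / 2) * (q + r - p - 1 + 2 * \<beta>) * (p + q + r + 1) * fst v)
           / ((p + 1) * (p + r - q + 2 * \<beta>) * (p + q - r + 2 * \<beta>))
     in (a, (p + \<beta>) * (q + r - p - 1 + 2 * \<beta>) * (p + q + r + 1) * fst v
           + (p + 3 / 2 - \<beta>) * (p + r - q + 2 * \<beta>) * (p + q - r + 2 * \<beta>) * a))"

lemma ustep_swap: "ustep \<beta> p q r = ustep \<beta> p r q"
  by (rule ext) (simp add: ustep_def Let_def ac_simps)

lemma ustep_eqs:
  assumes "p + 1 \<noteq> 0" "p + r - q + 2 * \<beta> \<noteq> 0" "p + q - r + 2 * \<beta> \<noteq> 0"
  shows "(p + 1) * (p + r - q + 2 * \<beta>) * (p + q - r + 2 * \<beta>) * fst (ustep \<beta> p q r v)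
      = snd v - (p + 2 * \<beta> - 1 / 2) * (q + r - p - 1 + 2 * \<beta>) * (p + q + r + 1) * fst v"
    and "snd (ustep \<beta> p q r v) = (p + \<beta>) * (q + r - p - 1 + 2 * \<beta>) * (p + q + r + 1) * fst v
      + (p + 3 / 2 - \<beta>) * (p + r - q + 2 * \<beta>) * (p + q - r + 2 * \<beta>) * fst (ustep \<beta> p q r v)"
  using assms by (simp_all add: ustep_def Let_def)

text \<open>Two routes lead to the opposite corner of a lattice square. Both results are expressed
  through the pair \<open>(a, x)\<close> at the start, and exchanging \<open>p\<close> and
  \<open>q\<close> exchanges the two expressions; their equality is a polynomial identity.\<close>

lemma ustep_commute:
  assumes nz: "p + 1 \<noteq> 0" "q + 1 \<noteq> 0" "p + r - q + 2 * \<beta> \<noteq> 0" "q + r - p + 2 * \<beta> \<noteq> 0"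
    "p + q - r + 2 * \<beta> \<noteq> 0" "p + q - r + 1 + 2 * \<beta> \<noteq> 0"
    "q + r - p - 1 + 2 * \<beta> \<noteq> 0" "p + r - q - 1 + 2 * \<beta> \<noteq> 0"
  shows "ustep \<beta> q (p + 1) r (ustep \<beta> p q r v) = ustep \<beta> p (q + 1) r (ustep \<beta> q p r v)"
proof -
  obtain a x where v: "v = (a, x)" by force
  obtain a1 x1 where v1: "ustep \<beta> p q r v = (a1, x1)" by force
  obtain a2 x2 where v2: "ustep \<beta> q p r v = (a2, x2)" by force
  obtain a12 x12 where v12: "ustep \<beta> q (p + 1) r (a1, x1) = (a12, x12)" by force
  obtain a21 x21 where v21: "ustep \<beta> p (q + 1) r (a2, x2) = (a21, x21)" by force
  define c d m c' m' s where "c = p + r - q + 2 * \<beta>" and "d = p + q - r + 2 * \<beta>"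
    and "m = q + r - p - 1 + 2 * \<beta>" and "c' = q + r - p + 2 * \<beta>" and "m' = p + r - q - 1 + 2 * \<beta>"
    and "s = p + q + r + 1"
  note defs = c_def d_def m_def c'_def m'_def s_def
  have h1: "(p + 1) * c * d * a1 = x - (p + 2 * \<beta> - 1 / 2) * m * s * a"
    and g1: "x1 = (p + \<beta>) * m * s * a + (p + 3 / 2 - \<beta>) * c * d * a1"
    using ustep_eqs[of p r q \<beta> v] nz by (simp_all add: v v1[unfolded v] defs)
  have h2: "(q + 1) * c' * d * a2 = x - (q + 2 * \<beta> - 1 / 2) * m' * s * a"
    and g2: "x2 = (q + \<beta>) * m' * s * a + (q + 3 / 2 - \<beta>) * c' * d * a2"
    using ustep_eqs[of q r p \<beta> v] nz by (simp_all add: v v2[unfolded v] defs algebra_simps)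
  have e: "q + r - (p + 1) + 2 * \<beta> = m" "q + (p + 1) - r + 2 * \<beta> = d + 1"
    "p + 1 + r - q - 1 + 2 * \<beta> = c" "q + (p + 1) + r + 1 = s + 1"
    "p + r - (q + 1) + 2 * \<beta> = m'" "p + (q + 1) - r + 2 * \<beta> = d + 1"
    "q + 1 + r - p - 1 + 2 * \<beta> = c'" "p + (q + 1) + r + 1 = s + 1"
    by (simp_all add: defs)
  have d1: "d + 1 \<noteq> 0" using nz(6) by (simp add: d_def add_ac add_diff_eq diff_add_eq)
  have h12: "(q + 1) * m * (d + 1) * a12 = x1 - (q + 2 * \<beta> - 1 / 2) * c * (s + 1) * a1"
    and g12: "x12 = (q + \<beta>) * c * (s + 1) * a1 + (q + 3 / 2 - \<beta>) * m * (d + 1) * a12"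
    using ustep_eqs[of q r "p + 1" \<beta> "(a1, x1)", unfolded e v12 fst_conv snd_conv] nz(2,7) d1
    by (simp_all add: m_def)
  have h21: "(p + 1) * m' * (d + 1) * a21 = x2 - (p + 2 * \<beta> - 1 / 2) * c' * (s + 1) * a2"
    and g21: "x21 = (p + \<beta>) * c' * (s + 1) * a2 + (p + 3 / 2 - \<beta>) * m' * (d + 1) * a21"
    using ustep_eqs[of p r "q + 1" \<beta> "(a2, x2)", unfolded e v21 fst_conv snd_conv] nz(1,8) d1
    by (simp_all add: m'_def)
  \<comment> \<open>Once \<open>x1\<close> is inserted, the right side of \<open>h12\<close> is
    divisible by \<open>m\<close>; the quotient is the second relation of (iv) at the intermediate
    point.\<close>
  have "m * ((q + 1) * (d + 1) * a12) = m * ((p + \<beta>) * s * a - (p + q + 1 + \<beta>) * c * a1)"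
    using h12 unfolding g1 defs by algebra
  then have e12: "(q + 1) * (d + 1) * a12 = (p + \<beta>) * s * a - (p + q + 1 + \<beta>) * c * a1"
    using nz by (simp add: m_def)
  have "m' * ((p + 1) * (d + 1) * a21) = m' * ((q + \<beta>) * s * a - (p + q + 1 + \<beta>) * c' * a2)"
    using h21 unfolding g2 defs by algebra
  then have e21: "(p + 1) * (d + 1) * a21 = (q + \<beta>) * s * a - (p + q + 1 + \<beta>) * c' * a2"
    using nz by (simp add: m'_def)
  \<comment> \<open>The factor \<open>(p + 1) * d\<close> allows \<open>h1\<close> to replace
    \<open>a1\<close> by \<open>a\<close> and \<open>x\<close>.\<close>
  have k12: "(p + 1) * (q + 1) * d * (d + 1) * a12 =
      (p + 1) * d * (p + \<beta>) * s * a - (p + q + 1 + \<beta>) * (x - (p + 2 * \<beta> - 1 / 2) * m * s * a)"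
    using e12 h1 by algebra
  have k21: "(p + 1) * (q + 1) * d * (d + 1) * a21 =
      (q + 1) * d * (q + \<beta>) * s * a - (p + q + 1 + \<beta>) * (x - (q + 2 * \<beta> - 1 / 2) * m' * s * a)"
    using e21 h2 by algebra
  have "(p + 1) * d * (p + \<beta>) * s * a - (p + q + 1 + \<beta>) * (x - (p + 2 * \<beta> - 1 / 2) * m * s * a)
     = (q + 1) * d * (q + \<beta>) * s * a - (p + q + 1 + \<beta>) * (x - (q + 2 * \<beta> - 1 / 2) * m' * s * a)"
    unfolding defs by algebra
  then have "((p + 1) * (q + 1) * d * (d + 1)) * a12 = ((p + 1) * (q + 1) * d * (d + 1)) * a21"
    using k12 k21 by simp
  moreover have "(p + 1) * (q + 1) * d * (d + 1) \<noteq> 0"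
    using nz d1 by (simp add: d_def)
  ultimately have a: "a12 = a21" by simp
  have "(p + 1) * (q + 1) * d * x12 = (q + 1) * (q + \<beta>) * (s + 1) * (x - (p + 2 * \<beta> - 1 / 2) * m * s * a)
     + (q + 3 / 2 - \<beta>) * m * ((p + 1) * d * (p + \<beta>) * s * a - (p + q + 1 + \<beta>) * (x - (p + 2 * \<beta> - 1 / 2) * m * s * a))"
    unfolding g12 using k12 h1 by algebra
  also have "\<dots> = (p + 1) * (p + \<beta>) * (s + 1) * (x - (q + 2 * \<beta> - 1 / 2) * m' * s * a)
     + (p + 3 / 2 - \<beta>) * m' * ((q + 1) * d * (q + \<beta>) * s * a - (p + q + 1 + \<beta>) * (x - (q + 2 * \<beta> - 1 / 2) * m' * s * a))"
    unfolding defs by algebra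
  also have "\<dots> = (p + 1) * (q + 1) * d * x21"
    unfolding g21 using k21 h2 by algebra
  finally have "x12 = x21" using nz by (simp add: d_def)
  then show ?thesis using a by (simp add: v1 v2 v12 v21)
qed

text \<open>The hypothesis says that \<open>X\<^sup>k\<^sup>,\<^sup>-\<close> equals \<open>X\<close> on the face \<open>n\<^sub>k = 0\<close> with \<open>A\<close> extended by zero.\<close>

lemma ustep_boundary:
  assumes nz: "q + 1 \<noteq> 0" "q + r + 2 * \<beta> \<noteq> 0" "q - r + 2 * \<beta> \<noteq> 0"
    and v: "snd v = (1 / 2 - \<beta>) * (r - q - 1 + 2 * \<beta>) * (q - r - 1 + 2 * \<beta>) * fst v"
  shows "snd (ustep \<beta> q 0 r v)
    = (1 / 2 - \<beta>) * (r - q - 2 + 2 * \<beta>) * (q - r + 2 * \<beta>) * fst (ustep \<beta> q 0 r v)"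
proof -
  define a where "a = fst (ustep \<beta> q 0 r v)"
  have h: "(q + 1) * (q + r + 2 * \<beta>) * (q - r + 2 * \<beta>) * a
      = snd v - (q + 2 * \<beta> - 1 / 2) * (r - q - 1 + 2 * \<beta>) * (q + r + 1) * fst v"
    and g: "snd (ustep \<beta> q 0 r v) = (q + \<beta>) * (r - q - 1 + 2 * \<beta>) * (q + r + 1) * fst v
      + (q + 3 / 2 - \<beta>) * (q + r + 2 * \<beta>) * (q - r + 2 * \<beta>) * a"
    using ustep_eqs[of q r 0 \<beta> v] nz by (simp_all add: a_def)
  \<comment> \<open>With \<open>snd v\<close> a multiple of \<open>fst v\<close>, the right side of
    \<open>h\<close> contains the factor \<open>q + r + 2 * \<beta>\<close>, which can be
    cancelled.\<close>
  have "(q + r + 2 * \<beta>) * ((q + 1) * (q - r + 2 * \<beta>) * a)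
      = (q + r + 2 * \<beta>) * (- (r - q - 1 + 2 * \<beta>) * (q + \<beta>) * fst v)"
    using h unfolding v by algebra
  then have "(q + 1) * (q - r + 2 * \<beta>) * a = - (r - q - 1 + 2 * \<beta>) * (q + \<beta>) * fst v"
    using nz by simp
  then show ?thesis unfolding g a_def[symmetric] by algebra
qed

section \<open>Integration of the transition maps over the octant\<close>

text \<open>One fixed path from the origin: the third coordinate is raised first, then the second,
  then the first. The start value of \<open>X\<close> is \<open>X_minus\<close> at the origin with
  \<open>A 0 = 1\<close> and \<open>A\<close> extended by zero.\<close>

fun flat :: "real \<Rightarrow> nat \<Rightarrow> nat \<Rightarrow> nat \<Rightarrow> real \<times> real" where
  "flat \<beta> 0 0 0 = (1, (1 / 2 - \<beta>) * (2 * \<beta> - 1)\<^sup>2)"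
| "flat \<beta> 0 0 (Suc c) = ustep \<beta> (of_nat c) 0 0 (flat \<beta> 0 0 c)"
| "flat \<beta> 0 (Suc b) c = ustep \<beta> (of_nat b) 0 (of_nat c) (flat \<beta> 0 b c)"
| "flat \<beta> (Suc a) b c = ustep \<beta> (of_nat a) (of_nat b) (of_nat c) (flat \<beta> a b c)"

lemma ustep_commute_nat:
  assumes "2 * \<beta> \<notin> \<int>"
  shows "ustep \<beta> (of_nat b) (of_nat (Suc a)) (of_nat c) (ustep \<beta> (of_nat a) (of_nat b) (of_nat c) v)
       = ustep \<beta> (of_nat a) (of_nat (Suc b)) (of_nat c) (ustep \<beta> (of_nat b) (of_nat a) (of_nat c) v)"
  using ustep_commute[of "of_nat a" "of_nat b" "of_nat c" \<beta> v]
    of_int_plus_generic[OF assms, of "int a + int c - int b"]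
    of_int_plus_generic[OF assms, of "int b + int c - int a"]
    of_int_plus_generic[OF assms, of "int a + int b - int c"]
    of_int_plus_generic[OF assms, of "int a + int b - int c + 1"]
    of_int_plus_generic[OF assms, of "int a + int c - int b - 1"]
    of_int_plus_generic[OF assms, of "int b + int c - int a - 1"]
  by (simp add: add.commute[of 1] del: of_nat_eq_0_iff)

text \<open>A step in the second direction is moved back past the steps in the first direction, to
  the place where the defining path performs it.\<close>

lemma flat_step2:
  assumes "2 * \<beta> \<notin> \<int>"
  shows "flat \<beta> a (Suc b) c = ustep \<beta> (of_nat b) (of_nat a) (of_nat c) (flat \<beta> a b c)"
proof (induction a)
  case (Suc a)
  then show ?case using ustep_commute_nat[OF assms, of b a c] by simp
qed simp

text \<open>A step in the third direction has to pass the steps in both other directions: the inner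
  induction handles the second, the outer one the first.\<close>

lemma flat_step3:
  assumes "2 * \<beta> \<notin> \<int>"
  shows "flat \<beta> a b (Suc c) = ustep \<beta> (of_nat c) (of_nat a) (of_nat b) (flat \<beta> a b c)"
proof (induction a)
  case 0
  show ?case
  proof (induction b)
    case (Suc b)
    then show ?case using ustep_commute_nat[OF assms, of c b 0 "flat \<beta> 0 b c"]
      by (simp add: ustep_swap[of _ _ 0])
  qed simp
next
  case (Suc a)
  then show ?case using ustep_commute_nat[OF assms, of c a b "flat \<beta> a b c"]
    by (simp add: ustep_swap[of _ _ _ "of_nat b"])
qed

definition flat3 :: "real \<Rightarrow> int ^ 3 \<Rightarrow> real \<times> real" where
  "flat3 \<beta> n = flat \<beta> (nat (n $ 1)) (nat (n $ 2)) (nat (n $ 3))"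

lemma flat3_step:
  assumes "2 * \<beta> \<notin> \<int>" "in_N0 n" "{j, k, l} = {1, 2, 3}"
  shows "flat3 \<beta> (n + evec j) = ustep \<beta> (of_int (n $ j)) (of_int (n $ k)) (of_int (n $ l)) (flat3 \<beta> n)"
proof -
  have pos: "0 \<le> n $ i" for i using assms(2) by (simp add: in_N0_def)
  have nat: "nat (n $ i + 1) = Suc (nat (n $ i))" "real (nat (n $ i)) = of_int (n $ i)" for i
    using pos[of i] by simp_all
  consider "j = 1 \<and> k = 2 \<and> l = 3 \<or> j = 1 \<and> k = 3 \<and> l = 2" | "j = 2 \<and> k = 1 \<and> l = 3 \<or> j = 2 \<and> k = 3 \<and> l = 1"
    | "j = 3 \<and> k = 1 \<and> l = 2 \<or> j = 3 \<and> k = 2 \<and> l = 1"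
    using triple_distinct[OF assms(3)] exhaust_3[of j] exhaust_3[of k] exhaust_3[of l] by auto
  then show ?thesis
  proof cases
    case 1
    then show ?thesis
      using ustep_swap[of \<beta> "of_int (n $ 1)" "of_int (n $ 2)" "of_int (n $ 3)"]
      by (auto simp: flat3_def evec_shift nat)
  next
    case 2
    then show ?thesis
      using ustep_swap[of \<beta> "of_int (n $ 2)" "of_int (n $ 1)" "of_int (n $ 3)"]
      by (auto simp: flat3_def evec_shift nat flat_step2[OF assms(1)])
  next
    case 3
    then show ?thesis
      using ustep_swap[of \<beta> "of_int (n $ 3)" "of_int (n $ 1)" "of_int (n $ 2)"]
      by (auto simp: flat3_def evec_shift nat flat_step3[OF assms(1)])
  qed
qed

section \<open>Boundary values and extension by zero\<close>

lemma exists_positive_coordinate: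
  assumes "in_N0 n" "n \<noteq> 0"
  shows "\<exists>l. 1 \<le> n $ l"
proof -
  from assms(2) obtain l where "n $ l \<noteq> 0" by (auto simp: vec_eq_iff)
  moreover have "0 \<le> n $ l" using assms(1) by (simp add: in_N0_def)
  ultimately have "1 \<le> n $ l" by linarith
  then show ?thesis by blast
qed

lemma absn_nonneg: "in_N0 n \<Longrightarrow> 0 \<le> absn n"
  by (simp add: in_N0_def absn_def sum_nonneg)

text \<open>Strong induction on |n|; the step comes with a direction \<open>l\<close> in which
  \<open>n\<close> can be lowered without leaving the octant.\<close>

lemma N0_induct [consumes 1, case_names zero step]:
  assumes "in_N0 n" and "P 0"
    and "\<And>n l. in_N0 n \<Longrightarrow> 1 \<le> n $ l \<Longrightarrow> (\<And>m. in_N0 m \<Longrightarrow> absn m < absn n \<Longrightarrow> P m) \<Longrightarrow> P n"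
  shows "P n"
  using assms(1)
proof (induction "nat (absn n)" arbitrary: n rule: less_induct)
  case less
  show ?case
  proof (cases "n = 0")
    case False
    then obtain l where "1 \<le> n $ l" using exists_positive_coordinate[OF less.prems] by blast
    moreover have "P m" if "in_N0 m" "absn m < absn n" for m
      using less.hyps[of m] absn_nonneg[OF that(1)] that by simp
    ultimately show ?thesis by (rule assms(3)[OF less.prems])
  qed (use assms(2) in simp)
qed

text \<open>The start value satisfies the relation, and \<open>ustep_boundary\<close> carries it
  along the face: a nonzero point with \<open>n $ j = 0\<close> has a positive coordinate other than
  \<open>j\<close>.\<close>

lemma flat3_boundary:
  assumes \<beta>: "2 * \<beta> \<notin> \<int>" and "in_N0 n" "{j, k, l} = {1, 2, 3}" "n $ j = 0"
  shows "snd (flat3 \<beta> n) = (1 / 2 - \<beta>) * (of_int (n $ l) - of_int (n $ k) - 1 + 2 * \<beta>)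
    * (of_int (n $ k) - of_int (n $ l) - 1 + 2 * \<beta>) * fst (flat3 \<beta> n)"
  using assms(2-4)
proof (induction n arbitrary: j k l rule: N0_induct)
  case zero
  then show ?case by (simp add: flat3_def power2_eq_square)
next
  case (step n i)
  have main: "snd (flat3 \<beta> n) = (1 / 2 - \<beta>) * (of_int (n $ l) - of_int (n $ k) - 1 + 2 * \<beta>)
    * (of_int (n $ k) - of_int (n $ l) - 1 + 2 * \<beta>) * fst (flat3 \<beta> n)"
    if t: "{j, k, l} = {1, 2, 3}" and i: "1 \<le> n $ k" and j: "n $ j = 0" for j k l
  proof -
    define m where "m = n - evec k"
    note d = triple_distinct[OF t]
    have m: "m $ j = 0" "m $ k = n $ k - 1" "m $ l = n $ l" "absn m < absn n" "n = m + evec k"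
      using d j by (simp_all add: m_def evec_shift)
    have mN: "in_N0 m"
      using step.hyps(1) i unfolding in_N0_triple[OF t] m(1-3) by simp
    define q r :: real where "q = of_int (m $ k)" and "r = of_int (m $ l)"
    have pos: "0 \<le> q" using mN by (simp add: q_def in_N0_def)
    have b: "snd (flat3 \<beta> m) = (1 / 2 - \<beta>) * (r - q - 1 + 2 * \<beta>) * (q - r - 1 + 2 * \<beta>) * fst (flat3 \<beta> m)"
      using step.IH[OF mN m(4) t m(1)] unfolding q_def r_def .
    have f: "flat3 \<beta> n = ustep \<beta> q 0 r (flat3 \<beta> m)"
      using flat3_step[OF \<beta> mN triple_permute(2)[OF t]] by (simp add: m(1) m(5)[symmetric] q_def r_def)
    have "snd (flat3 \<beta> n) = (1 / 2 - \<beta>) * (r - q - 2 + 2 * \<beta>) * (q - r + 2 * \<beta>) * fst (flat3 \<beta> n)"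
      unfolding f
      using of_int_plus_generic[OF \<beta>, of "m $ k + m $ l"] of_int_plus_generic[OF \<beta>, of "m $ k - m $ l"] pos
      by (intro ustep_boundary b) (simp_all add: q_def r_def)
    moreover have "r - q - 2 = of_int (n $ l) - of_int (n $ k) - 1" "q - r = of_int (n $ k) - of_int (n $ l) - 1"
      by (simp_all add: q_def r_def m(2,3))
    ultimately show ?thesis by simp
  qed
  have "i \<noteq> j" using step.hyps(2) step.prems(2) by auto
  moreover have "i \<in> {j, k, l}" using step.prems(1) UNIV_3 by (metis UNIV_I)
  ultimately consider "i = k" | "i = l" by auto
  then show ?case
  proof cases
    case 1
    then show ?thesis using main[OF step.prems(1)] step.hyps(2) step.prems(2) by simp
  next
    case 2
    then show ?thesis
      using main[OF triple_permute(1)[OF step.prems(1)]] step.hyps(2) step.prems(2)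
      by (simp add: mult_ac)
  qed
qed

lemma contiguous_generic_exists:
  assumes \<beta>: "2 * \<beta> \<notin> \<int>"
  shows "\<exists>A B. supported_N0 A \<and> supported_N0 B \<and> A 0 = 1 \<and> contiguous \<beta> A B"
proof -
  define A where "A n = (if in_N0 n then fst (flat3 \<beta> n) else 0)" for n
  define X where "X n = (if in_N0 n then snd (flat3 \<beta> n) else 0)" for n
  have sA: "supported_N0 A" and sX: "supported_N0 X" by (simp_all add: supported_N0_def A_def X_def)
  have A0: "A 0 = 1" by (simp add: A_def in_N0_def flat3_def)
  have step: "(p + 1) * (p + r - q + 2 * \<beta>) * (p + q - r + 2 * \<beta>) * A (n + evec j)
      = X n - (p + 2 * \<beta> - 1 / 2) * (q + r - p - 1 + 2 * \<beta>) * (p + q + r + 1) * A n"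
      "X (n + evec j) = (p + \<beta>) * (q + r - p - 1 + 2 * \<beta>) * (p + q + r + 1) * A n
      + (p + 3 / 2 - \<beta>) * (p + r - q + 2 * \<beta>) * (p + q - r + 2 * \<beta>) * A (n + evec j)"
    if t: "{j, k, l} = {1, 2, 3}" and n: "in_N0 n"
      and pqr: "p = of_int (n $ j)" "q = of_int (n $ k)" "r = of_int (n $ l)" for j k l n p q r
  proof -
    have "0 \<le> n $ i" for i using n by (simp add: in_N0_def)
    then have nj: "in_N0 (n + evec j)" and "p \<ge> 0"
      by (simp_all add: in_N0_def evec_shift pqr)
    then have nz: "p + 1 \<noteq> 0" "p + r - q + 2 * \<beta> \<noteq> 0" "p + q - r + 2 * \<beta> \<noteq> 0"
      using of_int_plus_generic[OF \<beta>, of "n $ j + n $ k - n $ l"]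
        of_int_plus_generic[OF \<beta>, of "n $ j + n $ l - n $ k"] by (simp_all add: pqr)
    have *: "A n = fst (flat3 \<beta> n)" "X n = snd (flat3 \<beta> n)"
      "A (n + evec j) = fst (ustep \<beta> p q r (flat3 \<beta> n))"
      "X (n + evec j) = snd (ustep \<beta> p q r (flat3 \<beta> n))"
      unfolding A_def X_def pqr flat3_step[OF \<beta> n t, symmetric] using n nj by simp_all
    show "(p + 1) * (p + r - q + 2 * \<beta>) * (p + q - r + 2 * \<beta>) * A (n + evec j)
      = X n - (p + 2 * \<beta> - 1 / 2) * (q + r - p - 1 + 2 * \<beta>) * (p + q + r + 1) * A n"
      "X (n + evec j) = (p + \<beta>) * (q + r - p - 1 + 2 * \<beta>) * (p + q + r + 1) * A n
      + (p + 3 / 2 - \<beta>) * (p + r - q + 2 * \<beta>) * (p + q - r + 2 * \<beta>) * A (n + evec j)"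
      unfolding * by (rule ustep_eqs[OF nz])+
  qed
  have plus: "X_plus \<beta> A j k l n = X n" if t: "{j, k, l} = {1, 2, 3}" for n j k l
  proof (cases "in_N0 n")
    case True
    show ?thesis using step(1)[OF t True refl refl refl] unfolding X_expand[OF t] by simp
  next
    case False
    \<comment> \<open>Outside the octant only the term in \<open>A (n + evec j)\<close> could
      survive; this needs \<open>n $ j = - 1\<close>, where its factor \<open>n $ j + 1\<close> is
      zero.\<close>
    then have "in_N0 (n + evec j) \<Longrightarrow> n $ j = - 1"
      using triple_distinct[OF t] unfolding in_N0_triple[OF t] by (simp add: evec_shift)
    then have "of_int (n $ j) + 1 = (0::real) \<or> A (n + evec j) = 0"
      by (auto simp: A_def)
    then show ?thesis using False unfolding X_expand[OF t] by (auto simp: A_def X_def)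
  qed
  have minus: "X_minus \<beta> A j k l n = X n" if t: "{j, k, l} = {1, 2, 3}" for n j k l
  proof (cases "in_N0 (n - evec j)")
    case True
    have "(n - evec j) $ j = n $ j - 1" "(n - evec j) $ k = n $ k" "(n - evec j) $ l = n $ l"
      using triple_distinct[OF t] by (simp_all add: evec_shift)
    then have "X n = (of_int (n $ j) - 1 + \<beta>) * (of_int (n $ k) + of_int (n $ l) - (of_int (n $ j) - 1) - 1 + 2 * \<beta>)
         * (of_int (n $ j) - 1 + of_int (n $ k) + of_int (n $ l) + 1) * A (n - evec j)
      + (of_int (n $ j) - 1 + 3 / 2 - \<beta>) * (of_int (n $ j) - 1 + of_int (n $ l) - of_int (n $ k) + 2 * \<beta>)
         * (of_int (n $ j) - 1 + of_int (n $ k) - of_int (n $ l) + 2 * \<beta>) * A n"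
      using step(2)[OF t True refl refl refl] by simp
    then show ?thesis unfolding X_expand[OF t] by algebra
  next
    case False
    then have A: "A (n - evec j) = 0" by (simp add: A_def)
    show ?thesis
    proof (cases "in_N0 n")
      case True
      \<comment> \<open>On this face \<open>X_minus\<close> reduces to its second term, which
        \<open>flat3_boundary\<close> identifies with \<open>X n\<close>.\<close>
      then have "n $ j = 0"
        using False triple_distinct[OF t] unfolding in_N0_triple[OF t] by (simp add: evec_shift)
      then show ?thesis using flat3_boundary[OF \<beta> True t] A True
        unfolding X_expand[OF t] by (simp add: X_def A_def)
    qed (unfold X_expand[OF t], simp add: A, simp add: A_def X_def)
  qed
  have "contiguous \<beta> A (\<lambda>n. - ((of_int (absn n))\<^sup>2 + 4 * \<beta> * of_int (absn n) + 4 * \<beta> - 1) / 4 * A n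
    - X n / (2 - 4 * \<beta>))" (is "contiguous \<beta> A ?B")
    by (rule contiguous_generic[OF \<beta> sA plus minus])
  moreover have "supported_N0 ?B" using sA sX by (simp add: supported_N0_def)
  ultimately show ?thesis using sA A0 by blast
qed

section \<open>Uniqueness and extension to all parameters\<close>

lemma exists_triple: "\<exists>j k. {j, k, l} = {1, 2, 3 :: 3}"
proof -
  have "{2, 3, 1} = {1, 2, 3 :: 3}" "{1, 3, 2} = {1, 2, 3 :: 3}" by auto
  then show ?thesis using exhaust_3[of l] by blast
qed

lemma AB_systemD:
  assumes "AB_system \<beta> A B" "{j, k, l} = {1, 2, 3}"
  shows "Lop \<beta> l A n = nabla j (nabla k B) n"
    and "B n = B (n - evec l - evec j) + B (n - evec l - evec k) - B (n - evec j - evec k)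
      - (2 * of_int (n $ j) * of_int (n $ k) + \<beta> * of_int (n $ j) + \<beta> * of_int (n $ k)
         + \<beta> * of_int (n $ l) + \<beta>\<^sup>2) * A n"
proof -
  have "\<forall>n j k l. {j, k, l} = {1, 2, 3} \<longrightarrow>
        Lop \<beta> l A n = nabla j (nabla k B) n \<and>
        (2 * of_int (n $ j) * of_int (n $ k)
           + \<beta> * of_int (n $ j) + \<beta> * of_int (n $ k) + \<beta> * of_int (n $ l) + \<beta>\<^sup>2) * A n
        = B (n - evec l - evec j) + B (n - evec l - evec k) - B n - B (n - evec j - evec k)"
    using assms(1) unfolding AB_system_def by (elim conjE)
  note * = this[rule_format, OF assms(2), of n]
  show "Lop \<beta> l A n = nabla j (nabla k B) n" using * by (rule conjunct1)
  show "B n = B (n - evec l - evec j) + B (n - evec l - evec k) - B (n - evec j - evec k)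
      - (2 * of_int (n $ j) * of_int (n $ k) + \<beta> * of_int (n $ j) + \<beta> * of_int (n $ k)
         + \<beta> * of_int (n $ l) + \<beta>\<^sup>2) * A n"
    using conjunct2[OF *] by linarith
qed

lemma AB_system_supported:
  assumes "AB_system \<beta> A B"
  shows "\<not> in_N0 n \<Longrightarrow> A n = 0" "\<not> in_N0 n \<Longrightarrow> B n = 0"
  using assms unfolding AB_system_def supported_N0_def by blast+

lemma AB_system_zero:
  assumes "AB_system \<beta> A B"
  shows "A 0 = 1" "B 0 = - \<beta>\<^sup>2"
proof -
  show A: "A 0 = 1" using assms by (simp add: AB_system_def)
  have "B (0 - evec i - evec j) = 0" for i j
    by (rule AB_system_supported(2)[OF assms]) (auto simp: in_N0_def evec_shift intro!: exI[of _ i])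
  then show "B 0 = - \<beta>\<^sup>2" using AB_systemD(2)[OF assms, of 1 2 3 0] A by simp
qed

lemma f_plus_pos: "\<beta> > 0 \<Longrightarrow> 1 \<le> m \<Longrightarrow> 0 < f_plus \<beta> m"
  unfolding f_plus_def by (intro mult_pos_pos) (simp_all add: add_nonneg_pos)

text \<open>The equation for \<open>Lop\<close> at \<open>n - evec l\<close>, solved for its leading
  term; all other points in it have smaller coordinate sum.\<close>

lemma AB_system_A:
  assumes "AB_system \<beta> A B" "\<beta> > 0" "{j, k, l} = {1, 2, 3}" "1 \<le> n $ l"
  shows "A n = (f_minus \<beta> (n $ l - 1) * A (n - evec l) + B (n - evec l) - B (n - evec l - evec k)
    - B (n - evec l - evec j) + B (n - evec l - evec j - evec k)) / f_plus \<beta> (n $ l)"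
proof -
  have "f_plus \<beta> (n $ l) * A n = f_minus \<beta> (n $ l - 1) * A (n - evec l) + nabla j (nabla k B) (n - evec l)"
    using AB_systemD(1)[OF assms(1,3), of "n - evec l"] by (simp add: Lop_def evec_shift)
  then show ?thesis using f_plus_pos[OF assms(2,4)]
    by (simp add: nabla_def field_simps)
qed

lemma AB_system_unique:
  assumes "AB_system \<beta> A B" "AB_system \<beta> A' B'" "\<beta> > 0"
  shows "A = A' \<and> B = B'"
proof -
  have "A n = A' n \<and> B n = B' n" if "in_N0 n" for n
    using that
  proof (induction n rule: N0_induct)
    case zero
    then show ?case using AB_system_zero[OF assms(1)] AB_system_zero[OF assms(2)] by simp
  next
    case (step n l)
    obtain j k where t: "{j, k, l} = {1, 2, 3}" using exists_triple[of l] by meson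
    have "A m = A' m \<and> B m = B' m" if "absn m < absn n" for m
      using step.IH[OF _ that] AB_system_supported[OF assms(1), of m] AB_system_supported[OF assms(2), of m]
      by (cases "in_N0 m") auto
    note IH = this[THEN conjunct1] this[THEN conjunct2]
    \<comment> \<open>\<open>A n\<close> comes first because the formula for \<open>B n\<close>
      contains it; the remaining terms of both are covered by the induction hypothesis.\<close>
    have "A n = A' n"
      unfolding AB_system_A[OF assms(1,3) t step.hyps(2)] AB_system_A[OF assms(2,3) t step.hyps(2)]
      by (simp add: IH)
    then show ?case
      unfolding AB_systemD(2)[OF assms(1) t, of n] AB_systemD(2)[OF assms(2) t, of n]
      by (simp add: IH)
  qed
  then show ?thesis
    using AB_system_supported[OF assms(1)] AB_system_supported[OF assms(2)]
    by (metis ext)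
qed

section \<open>From generic to arbitrary parameters\<close>

lemma generic_dense:
  fixes u v :: "real \<Rightarrow> real"
  assumes "continuous_on {0<..} u" "continuous_on {0<..} v"
    and "\<And>\<beta>. \<beta> > 0 \<Longrightarrow> 2 * \<beta> \<notin> \<int> \<Longrightarrow> u \<beta> = v \<beta>" and "\<beta> > 0"
  shows "u \<beta> = v \<beta>"
proof (rule ccontr)
  assume "u \<beta> \<noteq> v \<beta>"
  \<comment> \<open>The functions differ on a whole neighbourhood of \<beta>, which must contain a
    generic parameter since the exceptional ones are countable.\<close>
  have "open ({0<..} \<inter> (\<lambda>x. u x - v x) -` (- {0}))"
    using assms(1,2) by (intro continuous_open_preimage continuous_intros) simp_all
  then obtain e where e: "e > 0" "\<And>x. dist x \<beta> < e \<Longrightarrow> x > 0 \<and> u x \<noteq> v x"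
    unfolding open_dist using \<open>u \<beta> \<noteq> v \<beta>\<close> \<open>\<beta> > 0\<close> by force
  have "countable ((\<lambda>x::real. x / 2) ` \<int>)"
    by (intro countable_image) (simp add: Ints_def)
  moreover have "uncountable {\<beta><..<\<beta> + e}" using e(1) by (simp add: uncountable_open_interval)
  ultimately obtain y where y: "y \<in> {\<beta><..<\<beta> + e}" "y \<notin> (\<lambda>x::real. x / 2) ` \<int>"
    by (meson countable_subset subsetI)
  have "2 * y \<notin> \<int>"
  proof
    assume "2 * y \<in> \<int>"
    then have "(2 * y) / 2 \<in> (\<lambda>x::real. x / 2) ` \<int>" by (rule imageI)
    then show False using y(2) by simp
  qed
  then show False using e(2)[of y] assms(3)[of y] y(1) by (auto simp: dist_real_def)
qed

text \<open>The recursion behind uniqueness, read with \<beta> as a variable: it defines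
  \<open>g\<close> and \<open>h\<close> at the exceptional parameters too, and they are continuous
  there because \<open>f_plus\<close> has no zero for \<beta> > 0.\<close>

lemma AB_system_continuous:
  assumes AB: "\<And>\<beta>. \<beta> > 0 \<Longrightarrow> 2 * \<beta> \<notin> \<int> \<Longrightarrow> AB_system \<beta> (A \<beta>) (B \<beta>)"
  shows "\<exists>g h. continuous_on {0<..} g \<and> continuous_on {0<..} h \<and>
    (\<forall>\<beta>>0. 2 * \<beta> \<notin> \<int> \<longrightarrow> A \<beta> n = g \<beta> \<and> B \<beta> n = h \<beta>)" (is "?P n")
proof -
  have 0: "?P n" if "\<not> in_N0 n" for n
    using AB_system_supported[OF AB that] by (intro exI[of _ "\<lambda>_. 0"]) auto
  have "?P n" if "in_N0 n" for n
    using that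
  proof (induction n rule: N0_induct)
    case zero
    show ?case
      using AB_system_zero[OF AB]
      by (intro exI[of _ "\<lambda>_. 1"] exI[of _ "\<lambda>\<beta>. - \<beta>\<^sup>2"] conjI continuous_intros) auto
  next
    case (step n l)
    obtain j k where t: "{j, k, l} = {1, 2, 3}" using exists_triple[of l] by meson
    \<comment> \<open>Two choices fix the continuous functions at all earlier points at once; points
      outside the octant are included through \<open>0\<close>.\<close>
    have "\<forall>m\<in>{m. absn m < absn n}. ?P m" using step.IH 0 by blast
    from bchoice[OF this] obtain g where "\<forall>m\<in>{m. absn m < absn n}. \<exists>h. continuous_on {0<..} (g m) \<and>
      continuous_on {0<..} h \<and> (\<forall>\<beta>>0. 2 * \<beta> \<notin> \<int> \<longrightarrow> A \<beta> m = g m \<beta> \<and> B \<beta> m = h \<beta>)" by blast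
    from bchoice[OF this] obtain h where *: "\<forall>m\<in>{m. absn m < absn n}. continuous_on {0<..} (g m) \<and>
      continuous_on {0<..} (h m) \<and> (\<forall>\<beta>>0. 2 * \<beta> \<notin> \<int> \<longrightarrow> A \<beta> m = g m \<beta> \<and> B \<beta> m = h m \<beta>)" by blast
    have gh: "\<And>m. absn m < absn n \<Longrightarrow> continuous_on {0<..} (g m)"
      "\<And>m. absn m < absn n \<Longrightarrow> continuous_on {0<..} (h m)"
      "\<And>m \<beta>. absn m < absn n \<Longrightarrow> \<beta> > 0 \<Longrightarrow> 2 * \<beta> \<notin> \<int> \<Longrightarrow> A \<beta> m = g m \<beta>"
      "\<And>m \<beta>. absn m < absn n \<Longrightarrow> \<beta> > 0 \<Longrightarrow> 2 * \<beta> \<notin> \<int> \<Longrightarrow> B \<beta> m = h m \<beta>"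
      using * by simp_all
    define g' where "g' \<beta> = (f_minus \<beta> (n $ l - 1) * g (n - evec l) \<beta> + h (n - evec l) \<beta>
      - h (n - evec l - evec k) \<beta> - h (n - evec l - evec j) \<beta> + h (n - evec l - evec j - evec k) \<beta>)
      / f_plus \<beta> (n $ l)" for \<beta>
    define h' where "h' \<beta> = h (n - evec l - evec j) \<beta> + h (n - evec l - evec k) \<beta> - h (n - evec j - evec k) \<beta>
      - (2 * of_int (n $ j) * of_int (n $ k) + \<beta> * of_int (n $ j) + \<beta> * of_int (n $ k)
         + \<beta> * of_int (n $ l) + \<beta>\<^sup>2) * g' \<beta>" for \<beta>
    have "continuous_on {0<..} (\<lambda>\<beta>. f_minus \<beta> (n $ l - 1))" "continuous_on {0<..} (\<lambda>\<beta>. f_plus \<beta> (n $ l))"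
      unfolding f_minus_def f_plus_def by (intro continuous_intros)+
    moreover have "\<forall>\<beta>\<in>{0<..}. f_plus \<beta> (n $ l) \<noteq> 0"
      using f_plus_pos[OF _ step.hyps(2)] by force
    ultimately have g': "continuous_on {0<..} g'"
      unfolding g'_def by (intro continuous_intros gh) auto
    then have "continuous_on {0<..} h'"
      unfolding h'_def by (intro continuous_intros gh) auto
    moreover have "A \<beta> n = g' \<beta>" if "\<beta> > 0" "2 * \<beta> \<notin> \<int>" for \<beta>
      unfolding AB_system_A[OF AB[OF that] that(1) t step.hyps(2)] g'_def using that by (simp add: gh)
    moreover from this have "B \<beta> n = h' \<beta>" if "\<beta> > 0" "2 * \<beta> \<notin> \<int>" for \<beta>
      unfolding AB_systemD(2)[OF AB[OF that] t, of n] h'_def using that by (simp add: gh)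
    ultimately show ?case using g' by blast
  qed
  then show "?P n" using 0 by blast
qed

text \<open>Only support, normalisation and the relations in \<open>contiguous\<close> pass to the
  limit in \<beta>; the system is then derived from them at the given \<beta>.\<close>

lemma contiguous_exists:
  assumes "\<beta> > 0"
  shows "\<exists>A B. AB_system \<beta> A B \<and> contiguous \<beta> A B"
proof -
  have "\<forall>\<beta>. \<exists>A B. 2 * \<beta> \<notin> \<int> \<longrightarrow> supported_N0 A \<and> supported_N0 B \<and> A 0 = 1 \<and> contiguous \<beta> A B"
    using contiguous_generic_exists by blast
  then obtain A B where AB: "\<And>\<beta>. 2 * \<beta> \<notin> \<int> \<Longrightarrow>
      supported_N0 (A \<beta>) \<and> supported_N0 (B \<beta>) \<and> A \<beta> 0 = 1 \<and> contiguous \<beta> (A \<beta>) (B \<beta>)"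
    by metis
  then have sys: "AB_system \<beta> (A \<beta>) (B \<beta>)" if "2 * \<beta> \<notin> \<int>" for \<beta>
    using AB[OF that] by (intro contiguous_AB_system) simp_all
  have "\<forall>n. \<exists>g h. continuous_on {0<..} g \<and> continuous_on {0<..} h \<and>
    (\<forall>\<beta>>0. 2 * \<beta> \<notin> \<int> \<longrightarrow> A \<beta> n = g \<beta> \<and> B \<beta> n = h \<beta>)"
    by (intro allI AB_system_continuous sys)
  then obtain g h where gh: "\<And>n. continuous_on {0<..} (g n)" "\<And>n. continuous_on {0<..} (h n)"
    "\<And>n \<beta>. \<beta> > 0 \<Longrightarrow> 2 * \<beta> \<notin> \<int> \<Longrightarrow> A \<beta> n = g n \<beta>"
    "\<And>n \<beta>. \<beta> > 0 \<Longrightarrow> 2 * \<beta> \<notin> \<int> \<Longrightarrow> B \<beta> n = h n \<beta>"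
    by metis
  \<comment> \<open>At exceptional parameters these are the values of the continuous
    extensions.\<close>
  define G H where "G \<beta> n = g n \<beta>" and "H \<beta> n = h n \<beta>" for \<beta> n
  have G: "A \<beta> = G \<beta>" "B \<beta> = H \<beta>" if "\<beta> > 0" "2 * \<beta> \<notin> \<int>" for \<beta>
    using gh(3,4)[OF that] by (auto simp: G_def H_def)
  have cont [continuous_intros]: "continuous_on {0<..} (\<lambda>\<beta>. G \<beta> n)" "continuous_on {0<..} (\<lambda>\<beta>. H \<beta> n)" for n
    using gh(1,2) by (simp_all add: G_def H_def)
  have gen: "supported_N0 (G \<beta>)" "supported_N0 (H \<beta>)" "G \<beta> 0 = 1" "contiguous \<beta> (G \<beta>) (H \<beta>)"
    if "\<beta> > 0" "2 * \<beta> \<notin> \<int>" for \<beta>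
    using AB[OF that(2)] unfolding G[OF that] by auto
  have "G \<beta> n = 0" if "\<not> in_N0 n" for n
    by (rule generic_dense[of "\<lambda>\<beta>. G \<beta> n" "\<lambda>_. 0", OF _ _ _ assms])
      (use gen(1) that in \<open>auto simp: supported_N0_def intro: cont\<close>)
  moreover have "H \<beta> n = 0" if "\<not> in_N0 n" for n
    by (rule generic_dense[of "\<lambda>\<beta>. H \<beta> n" "\<lambda>_. 0", OF _ _ _ assms])
      (use gen(2) that in \<open>auto simp: supported_N0_def intro: cont\<close>)
  ultimately have "supported_N0 (G \<beta>)" "supported_N0 (H \<beta>)" by (simp_all add: supported_N0_def)
  moreover have "G \<beta> 0 = 1"
    by (rule generic_dense[of "\<lambda>\<beta>. G \<beta> 0" "\<lambda>_. 1", OF _ _ _ assms])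
      (use gen(3) in \<open>auto intro: cont\<close>)
  moreover have "contiguous \<beta> (G \<beta>) (H \<beta>)"
    unfolding contiguous_def
  proof (intro allI impI)
    fix n j k l assume t: "{j, k, l} = {1, 2, 3 :: 3}"
    note c = gen(4)[unfolded contiguous_def, rule_format, OF _ _ t, of _ n]
    have c1: "continuous_on {0<..} (\<lambda>\<beta>. (Pf j * Mf \<beta> k * G \<beta>) m)"
      "continuous_on {0<..} (\<lambda>\<beta>. (Qf \<beta> j * Mf \<beta> k * G \<beta>) m)"
      "continuous_on {0<..} (\<lambda>\<beta>. (Qf \<beta> j * Tf * G \<beta>) m)"
      "continuous_on {0<..} (\<lambda>\<beta>. ((Pf j - Pf k) * Tf * G \<beta>) m)"
      "continuous_on {0<..} (\<lambda>\<beta>. ((Pf j - Pf k) * Mf \<beta> l * G \<beta>) m)"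
      "continuous_on {0<..} (\<lambda>\<beta>. ((Pf j + Qf \<beta> k) * Mf \<beta> l * G \<beta>) m)" for j k l m
      unfolding fun_unfold times_fun_apply plus_fun_apply minus_apply by (intro continuous_intros)+
    show "(Pf j * Mf \<beta> k * G \<beta>) (n + evec j) - (Pf k * Mf \<beta> j * G \<beta>) (n + evec k)
       = ((Pf j - Pf k) * Tf * G \<beta>) n \<and>
     (Pf j * Mf \<beta> l * G \<beta>) (n + evec j) - (Qf \<beta> k * Tf * G \<beta>) (n - evec k)
       = - ((Pf k + Qf \<beta> j) * Mf \<beta> j * G \<beta>) n \<and>
     (Qf \<beta> j * Mf \<beta> j * G \<beta>) (n - evec j) - (Qf \<beta> k * Mf \<beta> k * G \<beta>) (n - evec k)
       = - ((Pf j - Pf k) * Mf \<beta> l * G \<beta>) n \<and>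
     2 * nabla l (H \<beta>) n = (Qf \<beta> l * Tf * G \<beta>) (n - evec l)
       - (2 * of_int (n $ j) * of_int (n $ k) + of_int (n $ l) * (of_int (absn n) - 1 + 2 * \<beta>)
          + 2 * \<beta> * (of_int (absn n) + \<beta>)) * G \<beta> n"
      (is "?a \<beta> = ?b \<beta> \<and> ?c \<beta> = ?d \<beta> \<and> ?e \<beta> = ?f \<beta> \<and> ?g \<beta> = ?h \<beta>")
    proof (intro conjI)
      show "?a \<beta> = ?b \<beta>"
        by (rule generic_dense[of ?a ?b, OF _ _ _ assms], (intro continuous_intros c1)+)
          (rule c[THEN conjunct1]; assumption)
      show "?c \<beta> = ?d \<beta>"
        by (rule generic_dense[of ?c ?d, OF _ _ _ assms], (intro continuous_intros c1)+)
          (rule c[THEN conjunct2, THEN conjunct1]; assumption)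
      show "?e \<beta> = ?f \<beta>"
        by (rule generic_dense[of ?e ?f, OF _ _ _ assms], (intro continuous_intros c1)+)
          (rule c[THEN conjunct2, THEN conjunct2, THEN conjunct1]; assumption)
      show "?g \<beta> = ?h \<beta>"
        by (rule generic_dense[of ?g ?h, OF _ _ _ assms], unfold nabla_def, (intro continuous_intros c1)+)
          (rule c[THEN conjunct2, THEN conjunct2, THEN conjunct2, unfolded nabla_def]; assumption)
    qed
  qed
  ultimately show ?thesis using contiguous_AB_system by blast
qed

section \<open>Consequences of the system\<close>

lemma AB_system_permute:
  assumes "AB_system \<beta> A B" and \<sigma>: "\<sigma> permutes (UNIV :: 3 set)"
  shows "AB_system \<beta> (\<lambda>n. A (\<chi> i. n $ \<sigma> i)) (\<lambda>n. B (\<chi> i. n $ \<sigma> i))"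
proof -
  define \<tau> :: "int ^ 3 \<Rightarrow> int ^ 3" where "\<tau> n = (\<chi> i. n $ \<sigma> i)" for n
  \<comment> \<open>Since \<open>\<tau>\<close> turns a shift by \<open>evec j\<close> into one by
    \<open>evec (\<rho> j)\<close>, the equations for \<open>j\<close>, \<open>k\<close>,
    \<open>l\<close> at \<open>n\<close> are the original ones for \<open>\<rho> j\<close>,
    \<open>\<rho> k\<close>, \<open>\<rho> l\<close> at \<open>\<tau> n\<close>.\<close>
  define \<rho> where "\<rho> = inv \<sigma>"
  have \<sigma>\<rho>: "\<sigma> i = j \<longleftrightarrow> i = \<rho> j" for i j
    unfolding \<rho>_def using permutes_inv_eq[OF \<sigma>] by metis
  have \<tau>: "\<tau> (n + evec j) = \<tau> n + evec (\<rho> j)" "\<tau> (n - evec j) = \<tau> n - evec (\<rho> j)"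
    for n j
    by (simp_all add: \<tau>_def vec_eq_iff evec_shift \<sigma>\<rho>)
  have \<tau>_nth: "\<tau> n $ \<rho> j = n $ j" for n j
    using \<sigma>\<rho>[of "\<rho> j" j] by (simp add: \<tau>_def)
  have N0: "in_N0 (\<tau> n) = in_N0 n" for n
    unfolding in_N0_def \<tau>_def using \<sigma>\<rho> by (metis vec_lambda_beta)
  have \<tau>0: "\<tau> 0 = 0" by (simp add: \<tau>_def vec_eq_iff)
  have t: "{\<rho> j, \<rho> k, \<rho> l} = {1, 2, 3}" if "{j, k, l} = {1, 2, 3}" for j k l
  proof -
    have "{\<rho> j, \<rho> k, \<rho> l} = \<rho> ` {j, k, l}" by simp
    also have "\<dots> = UNIV"
      unfolding that UNIV_3[symmetric] \<rho>_def by (rule permutes_image[OF permutes_inv[OF \<sigma>]])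
    finally show ?thesis by (simp only: UNIV_3)
  qed
  have "AB_system \<beta> (\<lambda>n. A (\<tau> n)) (\<lambda>n. B (\<tau> n))"
    unfolding AB_system_def
  proof (intro conjI allI impI)
    show "supported_N0 (\<lambda>n. A (\<tau> n))" "supported_N0 (\<lambda>n. B (\<tau> n))"
      using AB_system_supported[OF assms(1)] by (simp_all add: supported_N0_def N0)
    show "A (\<tau> 0) = 1" using AB_system_zero(1)[OF assms(1)] by (simp add: \<tau>0)
    fix n j k l assume jkl: "{j, k, l} = {1, 2, 3 :: 3}"
    show "Lop \<beta> l (\<lambda>n. A (\<tau> n)) n = nabla j (nabla k (\<lambda>n. B (\<tau> n))) n"
      using AB_systemD(1)[OF assms(1) t[OF jkl], of "\<tau> n"]
      by (simp add: Lop_def nabla_def \<tau> \<tau>_nth)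
    show "(2 * of_int (n $ j) * of_int (n $ k)
           + \<beta> * of_int (n $ j) + \<beta> * of_int (n $ k) + \<beta> * of_int (n $ l) + \<beta>\<^sup>2) * A (\<tau> n)
        = B (\<tau> (n - evec l - evec j)) + B (\<tau> (n - evec l - evec k)) - B (\<tau> n) - B (\<tau> (n - evec j - evec k))"
      using AB_systemD(2)[OF assms(1) t[OF jkl], of "\<tau> n"]
      by (simp add: \<tau> \<tau>_nth)
  qed
  then show ?thesis unfolding \<tau>_def .
qed

text \<open>A permuted solution solves the same system, so uniqueness identifies it with the
  original.\<close>

lemma AB_system_symmetric:
  assumes "AB_system \<beta> A B" "\<beta> > 0"
  shows "symmetric_fun A" "symmetric_fun B"
proof -
  have "A = (\<lambda>n. A (\<chi> i. n $ \<sigma> i)) \<and> B = (\<lambda>n. B (\<chi> i. n $ \<sigma> i))" if "\<sigma> permutes UNIV" for \<sigma>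
    by (rule AB_system_unique[OF assms(1) AB_system_permute[OF assms(1) that] assms(2)])
  then show "symmetric_fun A" "symmetric_fun B"
    unfolding symmetric_fun_def by (metis, metis)
qed

text \<open>Both sides are the mixed difference of \<open>B\<close> in all three directions, and
  differences commute.\<close>

lemma AB_system_Hop:
  assumes "AB_system \<beta> A B"
  shows "Hop \<beta> j A n = Hop \<beta> k A n"
proof (cases "j = k")
  case False
  obtain l where t: "{j, l, k} = {1, 2, 3}"
  proof -
    have "\<exists>l. {j, l, k} = {1, 2, 3}"
      using False exhaust_3[of j] exhaust_3[of k] by (auto simp: insert_commute)
    then show ?thesis using that by meson
  qed
  have "Lop \<beta> k A = nabla j (nabla l B)" "Lop \<beta> j A = nabla k (nabla l B)"
    using AB_systemD(1)[OF assms t] AB_systemD(1)[OF assms triple_permute(5)[OF t]] by auto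
  then show ?thesis by (simp add: Hop_def nabla_def algebra_simps)
qed simp

section \<open>Explicit values on the face \<open>n $ 3 = 0\<close>\<close>

lemma vector_shift:
  "vector [a, b, c] + evec 1 = (vector [a + 1, b, c] :: int ^ 3)"
  "vector [a, b, c] + evec 2 = (vector [a, b + 1, c] :: int ^ 3)"
  "vector [a, b, c] + evec 3 = (vector [a, b, c + 1] :: int ^ 3)"
  "vector [a, b, c] - evec 1 = (vector [a - 1, b, c] :: int ^ 3)"
  "vector [a, b, c] - evec 2 = (vector [a, b - 1, c] :: int ^ 3)"
  "vector [a, b, c] - evec 3 = (vector [a, b, c - 1] :: int ^ 3)"
  by (simp_all add: vec_eq_iff forall_3 evec_shift)

lemma in_N0_vector: "in_N0 (vector [a, b, c]) \<longleftrightarrow> 0 \<le> a \<and> 0 \<le> b \<and> 0 \<le> c"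
  by (simp add: in_N0_def forall_3)

lemma AB_system_face:
  fixes F G :: "nat \<Rightarrow> nat \<Rightarrow> real"
  assumes AB: "AB_system \<beta> A B"
  defines "F \<equiv> \<lambda>a b. A (vector [int a, int b, 0])" and "G \<equiv> \<lambda>a b. B (vector [int a, int b, 0])"
  shows "G a b = - (real a + \<beta>) * (real b + \<beta>) * F a b"
    and "(real a + 1) * (real b + 1) * F (Suc a) (Suc b) = (real a + \<beta>) * (real b + \<beta>) * F a b"
    and "(real a + 1) * (real a + 2 * \<beta>) * F (Suc a) 0 = (real a + \<beta>) * (real a + 1 - 2 * \<beta>) * F a 0"
    and "(real b + 1) * (real b + 2 * \<beta>) * F 0 (Suc b) = (real b + \<beta>) * (real b + 1 - 2 * \<beta>) * F 0 b"
    and "F 0 0 = 1"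
proof -
  have t: "{1, 2, 3} = {1, 2, 3 :: 3}" "{2, 3, 1} = {1, 2, 3 :: 3}" "{1, 3, 2} = {1, 2, 3 :: 3}" by auto
  have zero: "B (vector [x, y, z]) = 0" if "x < 0 \<or> y < 0 \<or> z < 0" for x y z
    using that by (intro AB_system_supported(2)[OF AB]) (auto simp: in_N0_vector)
  \<comment> \<open>Taken with \<open>l = 3\<close> and with \<open>l = 1\<close>, the second
    equation contains \<open>B\<close> at (a-1, b-1, 0) with opposite signs. The sum gives
    \<open>G\<close> in terms of \<open>F\<close>, the difference the diagonal recursion.\<close>
  have 1: "G a b = - B (vector [int a - 1, int b - 1, 0]) - (2 * real a * real b + \<beta> * real a + \<beta> * real b + \<beta>\<^sup>2) * F a b" for a b
    using AB_systemD(2)[OF AB t(1), of "vector [int a, int b, 0]"]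
    by (simp add: F_def G_def vector_shift zero)
  have 2: "G a b = B (vector [int a - 1, int b - 1, 0]) - (\<beta> * real a + \<beta> * real b + \<beta>\<^sup>2) * F a b" for a b
    using AB_systemD(2)[OF AB t(2), of "vector [int a, int b, 0]"]
    by (simp add: F_def G_def vector_shift zero add_ac)
  show GF: "G a b = - (real a + \<beta>) * (real b + \<beta>) * F a b" for a b
    using 1[of a b] 2[of a b] by (simp add: algebra_simps power2_eq_square)
  show "(real a + 1) * (real b + 1) * F (Suc a) (Suc b) = (real a + \<beta>) * (real b + \<beta>) * F a b"
    using 1[of "Suc a" "Suc b"] 2[of "Suc a" "Suc b"] GF[of a b]
    by (simp add: G_def algebra_simps power2_eq_square)
  \<comment> \<open>On an axis the mixed difference of \<open>B\<close> across it reduces to the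
    value at the point itself, which \<open>GF\<close> expresses through \<open>A\<close>.\<close>
  show "(real a + 1) * (real a + 2 * \<beta>) * F (Suc a) 0 = (real a + \<beta>) * (real a + 1 - 2 * \<beta>) * F a 0"
    using AB_systemD(1)[OF AB t(2), of "vector [int a, 0, 0]"] GF[of a 0]
    by (simp add: Lop_def nabla_def vector_shift zero F_def G_def f_plus_def f_minus_def)
      (simp add: algebra_simps)
  show "(real b + 1) * (real b + 2 * \<beta>) * F 0 (Suc b) = (real b + \<beta>) * (real b + 1 - 2 * \<beta>) * F 0 b"
    using AB_systemD(1)[OF AB t(3), of "vector [0, int b, 0]"] GF[of 0 b]
    by (simp add: Lop_def nabla_def vector_shift zero F_def G_def f_plus_def f_minus_def)
      (simp add: algebra_simps)
  have "vector [0, 0, 0] = (0 :: int ^ 3)" by (simp add: vec_eq_iff forall_3)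
  then show "F 0 0 = 1" using AB_system_zero(1)[OF AB] by (simp add: F_def)
qed

text \<open>\<open>diff_induct\<close> fits the recursions: the two axes are the base cases, and a
  diagonal step leaves |n1 - n2| unchanged.\<close>

lemma AB_system_face_formula:
  assumes AB: "AB_system \<beta> A B" and \<beta>: "\<beta> > 0"
  defines "d \<equiv> \<lambda>n1 n2. nat \<bar>int n1 - int n2\<bar>"
  shows "A (vector [int n1, int n2, 0]) =
      pochhammer \<beta> n1 * pochhammer \<beta> n2 * pochhammer (1 - 2 * \<beta>) (d n1 n2)
      / (pochhammer 1 n1 * pochhammer 1 n2 * pochhammer (2 * \<beta>) (d n1 n2))" (is "?A n1 n2")
    and "B (vector [int n1, int n2, 0]) =
      - (pochhammer \<beta> (n1 + 1) * pochhammer \<beta> (n2 + 1) * pochhammer (1 - 2 * \<beta>) (d n1 n2)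
      / (pochhammer 1 n1 * pochhammer 1 n2 * pochhammer (2 * \<beta>) (d n1 n2)))"
proof -
  note face = AB_system_face[OF AB]
  have axis: "f n = pochhammer \<beta> n * pochhammer (1 - 2 * \<beta>) n / (pochhammer 1 n * pochhammer (2 * \<beta>) n)"
    if "f 0 = 1" "\<And>a. (real a + 1) * (real a + 2 * \<beta>) * f (Suc a) = (real a + \<beta>) * (real a + 1 - 2 * \<beta>) * f a"
    for f :: "nat \<Rightarrow> real" and n
  proof (induction n)
    case (Suc n)
    have "real n + 1 \<noteq> 0" "real n + 2 * \<beta> \<noteq> 0" using \<beta> by (simp_all add: add_nonneg_eq_0_iff)
    then have "f (Suc n) = (real n + \<beta>) * (real n + 1 - 2 * \<beta>) * f n / ((real n + 1) * (real n + 2 * \<beta>))"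
      using that(2)[of n] by (simp add: eq_divide_eq mult_ac)
    then show ?case unfolding Suc by (simp add: pochhammer_Suc add_ac diff_add_eq mult_ac)
  qed (use that in simp)
  show A: "?A n1 n2" for n1 n2
  proof (induction n1 n2 rule: diff_induct)
    case (1 a)
    show ?case using axis[of "\<lambda>a. A (vector [int a, int 0, 0])", OF face(5,3)] by (simp add: d_def)
  next
    case (2 b)
    show ?case using axis[of "\<lambda>b. A (vector [int 0, int b, 0])" "Suc b", OF face(5,4)]
      by (simp add: d_def nat_add_distrib)
  next
    case (3 a b)
    have "d (Suc a) (Suc b) = d a b" by (simp add: d_def)
    moreover have "A (vector [int (Suc a), int (Suc b), 0])
        = (real a + \<beta>) * (real b + \<beta>) * A (vector [int a, int b, 0]) / ((real a + 1) * (real b + 1))"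
      using face(2)[of a b] by (simp add: eq_divide_eq mult_ac add_nonneg_eq_0_iff)
    ultimately show ?case unfolding 3 by (simp add: pochhammer_Suc add_ac mult_ac)
  qed
  have B: "B (vector [int n1, int n2, 0]) = - ((real n1 + \<beta>) * (real n2 + \<beta>) * A (vector [int n1, int n2, 0]))"
    using face(1)[of n1 n2] by (simp add: minus_mult_left)
  show "B (vector [int n1, int n2, 0]) =
      - (pochhammer \<beta> (n1 + 1) * pochhammer \<beta> (n2 + 1) * pochhammer (1 - 2 * \<beta>) (d n1 n2)
      / (pochhammer 1 n1 * pochhammer 1 n2 * pochhammer (2 * \<beta>) (d n1 n2)))"
    unfolding B A by (simp add: pochhammer_Suc ac_simps)
qed

section \<open>Vanishing for integral 2\<beta>\<close>

lemma symmetric_fun_triple: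
  assumes "symmetric_fun F" "{j, k, l} = {1, 2, 3}"
  shows "F n = F (vector [n $ j, n $ k, n $ l])"
proof -
  define \<sigma> :: "3 \<Rightarrow> 3" where "\<sigma> i = (if i = 1 then j else if i = 2 then k else l)" for i
  have "surj \<sigma>" using assms(2) unfolding UNIV_3 by (simp add: \<sigma>_def insert_commute)
  then have "\<sigma> permutes UNIV"
    by (intro bij_imp_permutes) (simp_all add: bij_def finite_UNIV_surj_inj)
  then have "F (\<chi> i. n $ \<sigma> i) = F n" using assms(1) by (simp add: symmetric_fun_def)
  moreover have "(\<chi> i. n $ \<sigma> i) = vector [n $ j, n $ k, n $ l]"
    by (simp add: vec_eq_iff forall_3 \<sigma>_def)
  ultimately show ?thesis by simp
qed

text \<open>Outside the (thickened) triangle inequality, \<open>A\<close> vanishes on the face \<open>c = 0\<close> because the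
  factor \<open>(1 - 2\<beta>)\<^sub>d\<close> contains \<open>0\<close>, and (ii) propagates the zeros to larger \<open>c\<close>.\<close>

lemma AB_system_A_vanishes_vector:
  assumes AB: "AB_system \<beta> A B" and \<beta>: "\<beta> > 0" "2 * \<beta> = of_nat N" and "a - b - c \<ge> int N"
  shows "A (vector [a, b, c]) = 0"
  using assms(4)
proof (induction "nat c" arbitrary: a b c rule: less_induct)
  case less
  have "N > 0" using \<beta> by (intro gr0I) simp
  consider "\<not> in_N0 (vector [a, b, c])" | "0 \<le> a \<and> 0 \<le> b \<and> c = 0" | "0 \<le> a \<and> 0 \<le> b \<and> c \<ge> 1"
    unfolding in_N0_vector by linarith
  then show ?case
  proof cases
    case 1
    then show ?thesis by (rule AB_system_supported(1)[OF AB])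
  next
    case 2
    define d where "d = nat \<bar>int (nat a) - int (nat b)\<bar>"
    have "N \<le> d" using 2 less.prems \<open>N > 0\<close> by (simp add: d_def)
    \<comment> \<open>The Pochhammer symbol starting at -(N-1) contains the factor zero once its
      length exceeds N-1.\<close>
    moreover have "1 - 2 * \<beta> = - of_nat (N - 1)" using \<beta> \<open>N > 0\<close> by (simp add: of_nat_diff)
    ultimately have "pochhammer (1 - 2 * \<beta>) d = 0"
      using \<open>N > 0\<close> by (simp only:) (rule pochhammer_of_nat_eq_0_lemma, simp)
    then show ?thesis
      using AB_system_face_formula(1)[OF AB \<beta>(1), of "nat a" "nat b", folded d_def] 2 by simp
  next
    case 3
    \<comment> \<open>In (ii) at (a, b, c-1), every point other than (a, b, c) has third coordinate
      below c and still satisfies the inequality with \<open>N\<close>.\<close>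
    have zero: "A (vector [a, b', c']) = 0" if "c' < c" "a - b' - c' \<ge> int N" for b' c'
      using less.hyps[of c' a b'] that 3 by (cases "0 \<le> c'") (auto simp: AB_system_supported(1)[OF AB] in_N0_vector)
    have "Hop \<beta> 3 A (vector [a, b, c - 1]) = Hop \<beta> 2 A (vector [a, b, c - 1])"
      by (rule AB_system_Hop[OF AB])
    then have "f_plus \<beta> c * A (vector [a, b, c]) = 0"
      using less.prems by (simp add: Hop_explicit vector_shift zero)
    then show ?thesis using f_plus_pos[OF \<beta>(1), of c] 3 by simp
  qed
qed

lemma AB_system_vanishes:
  assumes AB: "AB_system \<beta> A B" and \<beta>: "\<beta> > 0" "2 * \<beta> = of_nat N"
    and t: "{j, k, l} = {1, 2, 3}" and "n $ j - n $ k - n $ l \<ge> int N"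
  shows "A n = 0" "B n = 0"
proof -
  have A: "A n = 0" if "n $ j - n $ k - n $ l \<ge> int N" for n
    unfolding symmetric_fun_triple[OF AB_system_symmetric(1)[OF AB \<beta>(1)] t, of n]
    by (rule AB_system_A_vanishes_vector[OF AB \<beta> that])
  show "A n = 0" by (rule A[OF assms(5)])
  have B: "B n = 0" if "in_N0 n" "n $ j - n $ k - n $ l \<ge> int N" for n
    using that
  proof (induction n rule: N0_induct)
    case zero
    then show ?case using \<beta> by simp
  next
    case (step n i)
    \<comment> \<open>None of the three shifts in the equation for \<open>B n\<close> lowers
      \<open>n $ j - n $ k - n $ l\<close>, so the recursion stays in the region.\<close>
    have IH: "B m = 0" if "absn m < absn n" "m $ j - m $ k - m $ l \<ge> int N" for m
      using step.IH[of m] that AB_system_supported(2)[OF AB, of m] by (cases "in_N0 m") simp_all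
    show ?case
      using AB_systemD(2)[OF AB t, of n] A[OF step.prems] step.prems triple_distinct[OF t]
      by (simp add: IH evec_shift)
  qed
  show "B n = 0"
    using B[OF _ assms(5)] AB_system_supported(2)[OF AB] by blast
qed

section \<open>Assembly of existence, uniqueness and the seven properties\<close>

theorem theorem3p9:
  fixes \<beta> :: real
  assumes "\<beta> > 0"
  shows
    "(\<exists>!AB. AB_system \<beta> (fst AB) (snd AB)) \<and>
     (\<forall>A B. AB_system \<beta> A B \<longrightarrow>
       \<comment> \<open>(i)\<close>
       (symmetric_fun A \<and> symmetric_fun B) \<and>
       \<comment> \<open>(ii)\<close>
       (\<forall>n j k. Hop \<beta> j A n = Hop \<beta> k A n) \<and>
       \<comment> \<open>(iii)\<close>
       (\<forall>n1 n2 :: nat. let d = nat \<bar>int n1 - int n2\<bar> in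
          A (vector [int n1, int n2, 0]) =
            pochhammer \<beta> n1 * pochhammer \<beta> n2 * pochhammer (1 - 2 * \<beta>) d
            / (pochhammer 1 n1 * pochhammer 1 n2 * pochhammer (2 * \<beta>) d) \<and>
          B (vector [int n1, int n2, 0]) =
            - (pochhammer \<beta> (n1 + 1) * pochhammer \<beta> (n2 + 1) * pochhammer (1 - 2 * \<beta>) d
               / (pochhammer 1 n1 * pochhammer 1 n2 * pochhammer (2 * \<beta>) d))) \<and>
       \<comment> \<open>(iv)\<close>
       (\<forall>n j k l. {j, k, l} = {1, 2, 3} \<longrightarrow>
          (Pf j * Mf \<beta> k * A) (n + evec j) - (Pf k * Mf \<beta> j * A) (n + evec k)
            = ((Pf j - Pf k) * Tf * A) n \<and>
          (Pf j * Mf \<beta> l * A) (n + evec j) - (Qf \<beta> k * Tf * A) (n - evec k)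
            = - ((Pf k + Qf \<beta> j) * Mf \<beta> j * A) n \<and>
          (Qf \<beta> j * Mf \<beta> j * A) (n - evec j) - (Qf \<beta> k * Mf \<beta> k * A) (n - evec k)
            = - ((Pf j - Pf k) * Mf \<beta> l * A) n) \<and>
       \<comment> \<open>(v)\<close>
       (\<forall>n. in_N0 n \<longrightarrow>
          (\<forall>j k l j' k' l'. {j, k, l} = {1, 2, 3} \<and> {j', k', l'} = {1, 2, 3} \<longrightarrow>
             X_plus \<beta> A j k l n = X_plus \<beta> A j' k' l' n \<and>
             X_plus \<beta> A j k l n = X_minus \<beta> A j' k' l' n \<and>
             X_minus \<beta> A j k l n = X_minus \<beta> A j' k' l' n)) \<and>
       \<comment> \<open>(vi)\<close>
       (\<forall>n j k l. {j, k, l} = {1, 2, 3} \<longrightarrow>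
          2 * nabla l B n = (Pf j * Mf \<beta> k * A) (n + evec j) - (Qf \<beta> j * Tf * A) n \<and>
          2 * nabla l B n = (Pf k * Mf \<beta> j * A) (n + evec k) - (Qf \<beta> k * Tf * A) n \<and>
          2 * nabla l B n = - (Pf j * Mf \<beta> l * A) (n + evec j + evec k)
                            - (Qf \<beta> j * Mf \<beta> j * A) (n + evec k) \<and>
          2 * nabla l B n = - (Pf k * Mf \<beta> l * A) (n + evec j + evec k)
                            - (Qf \<beta> k * Mf \<beta> k * A) (n + evec j)) \<and>
       \<comment> \<open>(vii)\<close>
       (2 * \<beta> \<in> \<nat> \<longrightarrow>
          (\<forall>n. Min {Mf \<beta> j n | j. j \<in> {1, 2, 3}} \<le> - 1 \<longrightarrow> A n = 0 \<and> B n = 0)))"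
proof (rule conjI, goal_cases)
  case 1
  obtain A B where "AB_system \<beta> A B" using contiguous_exists[OF assms] by blast
  then show ?case
    using AB_system_unique[OF _ _ assms]
    by (intro ex1I[of _ "(A, B)"]) (auto simp: prod_eq_iff)
next
  case 2
  show ?case
  proof (intro allI impI, goal_cases)
    case (1 A B)
    note AB = this
    obtain A' B' where "AB_system \<beta> A' B'" "contiguous \<beta> A' B'"
      using contiguous_exists[OF assms] by blast
    \<comment> \<open>The relations were constructed for one solution; uniqueness makes it the given
      one.\<close>
    then have cont: "contiguous \<beta> A B" using AB_system_unique[OF AB _ assms] by blast
    have vi: "2 * nabla l B n = (Pf j * Mf \<beta> k * A) (n + evec j) - (Qf \<beta> j * Tf * A) n"
      "2 * nabla l B n = - (Pf j * Mf \<beta> l * A) (n + evec j + evec k) - (Qf \<beta> j * Mf \<beta> j * A) (n + evec k)"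
      if t: "{j, k, l} = {1, 2, 3}" for n j k l
      using contiguous_nabla[OF cont t, of n] triple_distinct[OF t]
      by (simp_all add: fun_unfold evec_shift absn_triple[OF t] algebra_simps)
    have iii: "let d = nat \<bar>int n1 - int n2\<bar> in
          A (vector [int n1, int n2, 0]) =
            pochhammer \<beta> n1 * pochhammer \<beta> n2 * pochhammer (1 - 2 * \<beta>) d
            / (pochhammer 1 n1 * pochhammer 1 n2 * pochhammer (2 * \<beta>) d) \<and>
          B (vector [int n1, int n2, 0]) =
            - (pochhammer \<beta> (n1 + 1) * pochhammer \<beta> (n2 + 1) * pochhammer (1 - 2 * \<beta>) d
               / (pochhammer 1 n1 * pochhammer 1 n2 * pochhammer (2 * \<beta>) d))" for n1 n2
      unfolding Let_def by (intro conjI AB_system_face_formula[OF AB assms])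
    have vii: "A n = 0 \<and> B n = 0" if nat: "2 * \<beta> \<in> \<nat>" and min: "Min {Mf \<beta> j n | j. j \<in> {1, 2, 3}} \<le> - 1" for n
    proof -
      obtain N where N: "2 * \<beta> = of_nat N" using nat by (rule Nats_cases)
      have "{Mf \<beta> j n | j. j \<in> {1, 2, 3}} = {Mf \<beta> 1 n, Mf \<beta> 2 n, Mf \<beta> 3 n}" by auto
      then have "Mf \<beta> 1 n \<le> - 1 \<or> Mf \<beta> 2 n \<le> - 1 \<or> Mf \<beta> 3 n \<le> - 1"
        using min by (simp add: min_le_iff_disj)
      then obtain l where l: "Mf \<beta> l n \<le> - 1" by blast
      obtain j k where t: "{j, k, l} = {1, 2, 3}" using exists_triple[of l] by meson
      \<comment> \<open>With 2\<beta> = N, this inequality is exactly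
        \<open>Mf \<beta> l n \<le> - 1\<close>.\<close>
      have "real_of_int (int N) \<le> real_of_int (n $ l - n $ j - n $ k)"
        using l by (simp add: Mf_def absn_triple[OF t] N)
      then have "int N \<le> n $ l - n $ j - n $ k" by (simp only: of_int_le_iff)
      then show ?thesis
        using AB_system_vanishes[OF AB assms N triple_permute(4)[OF t]] by simp
    qed
    show ?case
    proof (intro conjI allI impI, goal_cases)
      case 1 show ?case by (rule AB_system_symmetric(1)[OF AB assms])
    next
      case 2 show ?case by (rule AB_system_symmetric(2)[OF AB assms])
    next
      case 3 show ?case by (rule AB_system_Hop[OF AB])
    next
      case 4 show ?case by (rule iii)
    next
      case (5 n j k l)
      show ?case
        using cont[unfolded contiguous_def, rule_format, OF 5, of n] by (elim conjE)
    next
      case (6 n j k l)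
      show ?case
        using cont[unfolded contiguous_def, rule_format, OF 6, of n] by (elim conjE)
    next
      case (7 n j k l)
      show ?case
        using cont[unfolded contiguous_def, rule_format, OF 7, of n] by (elim conjE)
    next
      case (8 n j k l j' k' l')
      show ?case
        using contiguous_X[OF cont conjunct1[OF 8(2)]] contiguous_X[OF cont conjunct2[OF 8(2)]] by simp
    next
      case (9 n j k l j' k' l')
      show ?case
        using contiguous_X[OF cont conjunct1[OF 9(2)]] contiguous_X[OF cont conjunct2[OF 9(2)]] by simp
    next
      case (10 n j k l j' k' l')
      show ?case
        using contiguous_X[OF cont conjunct1[OF 10(2)]] contiguous_X[OF cont conjunct2[OF 10(2)]] by simp
    next
      case (11 n j k l)
      then show ?case by (rule vi(1))
    next
      case (12 n j k l)
      show ?case by (rule vi(1)[OF triple_permute(2)[OF 12]])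
    next
      case (13 n j k l)
      then show ?case by (rule vi(2))
    next
      case (14 n j k l)
      have "n + evec k + evec j = n + evec j + evec k" by (simp add: add_ac)
      then show ?case using vi(2)[OF triple_permute(2)[OF 14], of n] by (simp only:)
    next
      case (15 n)
      show ?case using vii[OF 15] by (rule conjunct1)
    next
      case (16 n)
      show ?case using vii[OF 16] by (rule conjunct2)
    qed
  qed
qed

end
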